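(* Let $T$ be a path-connected compact Hausdorff space, let $B=C(T)$ be the ring of real-valued continuous functions on $T$, let $\Delta$ be any set, and for each $\delta\in\Delta$ let $n_\delta\in\mathbb{N}$ with $n_\delta>1$. Let $$A=B[x_\delta:\delta\in\Delta]/(x_\delta^{n_\delta}:\delta\in\Delta).$$ If $\pi_{\mathbb{R}}^{alg}(B)\neq 0$, then $\pi_{\mathbb{R}}^{alg}(A)\neq 0$.
   Context: All rings are commutative with unity. A pm-ring is a ring in which every prime ideal is contained in a unique maximal ideal (both $A$ and $B$ in the claim are pm-rings, regarded as $\mathbb{R}$-algebras in the obvious way). For a pm-ring $R$, $\mathrm{Spec}(R)$ carries the Zariski topology and $\mathrm{Max}(R)$ the subspace topology; let $\mu:\mathrm{Spec}(R)\to\mathrm{Max}(R)$ send each prime to the unique maximal ideal containing it (this is a continuous retraction, and $\mathrm{Max}(R)$ is compact Hausdorff). For a pm-ring $R$ with an $\mathbb{R}$-algebra structure, $E_{\mathbb{R}}(R)$ is the monoid of unital $\mathbb{R}$-algebra endomorphisms of $R$. For $f\in E_{\mathbb{R}}(R)$, the induced spectral map $\mu_f:\mathrm{Max}(R)\to\mathrm{Max}(R)$ is the continuous map $\mu_f(M)=\mu(f^{-1}(M))$. Put $X_{\mathbb{R}}^R=\{\mu_f : f\in E_{\mathbb{R}}(R)\}$, with the subspace topology from the space $C(\mathrm{Max}(R),\mathrm{Max}(R))$ of continuous self-maps with the compact-open topology. The spectral fundamental group of $R$ is $\pi_{\mathbb{R}}^{alg}(R):=\pi_1(X_{\mathbb{R}}^R,\mu_{id_R})$,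 i.e. based-homotopy classes of loops in $X_{\mathbb{R}}^R$ at $\mu_{id_R}$ (the identity map of $\mathrm{Max}(R)$), with the operation induced by concatenation; $0$ denotes the trivial group. *)

theory Defs
  imports
    "HOL-Analysis.Analysis"
    "HOL-Algebra.Indexed_Polynomials"
    "HOL-Algebra.QuotRing"
    "HOL-Algebra.Elementary_Groups"
begin

section \<open>Prime and maximal spectrum\<close>

definition Spec :: "('a, 'm) ring_scheme \<Rightarrow> 'a set set"
  where "Spec R = {P. primeideal P R}"

definition Max_Spec :: "('a, 'm) ring_scheme \<Rightarrow> 'a set set"
  where "Max_Spec R = {M. maximalideal M R}"

text \<open>The closed sets are the sets of all primes containing a given set \<open>S\<close>; see
  \<open>openin_zariski\<close> and \<open>closedin_zariski\<close> below.\<close>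

definition zariski :: "('a, 'm) ring_scheme \<Rightarrow> 'a set topology"
  where "zariski R = topology (\<lambda>U. \<exists>S \<subseteq> carrier R. U = {P \<in> Spec R. \<not> S \<subseteq> P})"

lemma istopology_zariski:
  "istopology (\<lambda>U. \<exists>S \<subseteq> carrier R. U = {P \<in> Spec R. \<not> S \<subseteq> P})"
  unfolding istopology_def
proof (intro conjI allI impI)
  fix U V
  assume "\<exists>S \<subseteq> carrier R. U = {P \<in> Spec R. \<not> S \<subseteq> P}"
  then obtain S where S: "S \<subseteq> carrier R" "U = {P \<in> Spec R. \<not> S \<subseteq> P}" by blast
  assume "\<exists>S \<subseteq> carrier R. V = {P \<in> Spec R. \<not> S \<subseteq> P}"
  then obtain T where T: "T \<subseteq> carrier R" "V = {P \<in> Spec R. \<not> T \<subseteq> P}" by blast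
  define W where "W = {s \<otimes>\<^bsub>R\<^esub> t | s t. s \<in> S \<and> t \<in> T}"
  have prime_iff: "W \<subseteq> P \<longleftrightarrow> S \<subseteq> P \<or> T \<subseteq> P" if "P \<in> Spec R" for P
  proof -
    interpret primeideal P R using that by (simp add: Spec_def)
    show ?thesis
    proof
      assume W: "W \<subseteq> P"
      show "S \<subseteq> P \<or> T \<subseteq> P"
      proof (rule ccontr)
        assume "\<not> ?thesis"
        then obtain s t where st: "s \<in> S" "s \<notin> P" "t \<in> T" "t \<notin> P" by blast
        then have "s \<otimes>\<^bsub>R\<^esub> t \<in> P" using W by (auto simp: W_def)
        then show False using I_prime[of s t] st S T by blast
      qed
    next
      assume "S \<subseteq> P \<or> T \<subseteq> P"
      then show "W \<subseteq> P"
        using S T I_l_closed I_r_closed unfolding W_def by blast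
    qed
  qed
  have "W \<subseteq> carrier R \<or> Spec R = {}"
  proof (cases "Spec R = {}")
    case False
    then obtain P where "primeideal P R" by (auto simp: Spec_def)
    then interpret primeideal P R .
    show ?thesis using S T by (auto simp: W_def)
  qed simp
  then show "\<exists>S \<subseteq> carrier R. U \<inter> V = {P \<in> Spec R. \<not> S \<subseteq> P}"
  proof
    assume "W \<subseteq> carrier R"
    moreover have "U \<inter> V = {P \<in> Spec R. \<not> W \<subseteq> P}"
      using prime_iff S T by blast
    ultimately show ?thesis by blast
  next
    assume "Spec R = {}"
    then show ?thesis using S T by auto
  qed
next
  fix \<K>
  assume "\<forall>K\<in>\<K>. \<exists>S \<subseteq> carrier R. K = {P \<in> Spec R. \<not> S \<subseteq> P}"
  then obtain S where S: "\<And>K. K \<in> \<K> \<Longrightarrow> S K \<subseteq> carrier R \<and> K = {P \<in> Spec R. \<not> S K \<subseteq> P}"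
    by metis
  have "\<Union>\<K> = {P \<in> Spec R. \<not> (\<Union>K\<in>\<K>. S K) \<subseteq> P}"
  proof (intro equalityI subsetI)
    fix P assume "P \<in> \<Union>\<K>"
    then obtain K where K: "K \<in> \<K>" "P \<in> K" by blast
    then have "P \<in> Spec R" "\<not> S K \<subseteq> P" using S[of K] by auto
    then show "P \<in> {P \<in> Spec R. \<not> (\<Union>K\<in>\<K>. S K) \<subseteq> P}" using K by auto
  next
    fix P assume "P \<in> {P \<in> Spec R. \<not> (\<Union>K\<in>\<K>. S K) \<subseteq> P}"
    then obtain K where "K \<in> \<K>" "P \<in> Spec R" "\<not> S K \<subseteq> P" by blast
    then show "P \<in> \<Union>\<K>" using S[of K] by auto
  qed
  moreover have "(\<Union>K\<in>\<K>. S K) \<subseteq> carrier R" using S by blast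
  ultimately show "\<exists>S \<subseteq> carrier R. \<Union>\<K> = {P \<in> Spec R. \<not> S \<subseteq> P}" by blast
qed

lemma openin_zariski:
  "openin (zariski R) U \<longleftrightarrow> (\<exists>S \<subseteq> carrier R. U = {P \<in> Spec R. \<not> S \<subseteq> P})"
  by (simp only: zariski_def topology_inverse'[OF istopology_zariski])

lemma topspace_zariski: "topspace (zariski R) = Spec R"
proof
  show "topspace (zariski R) \<subseteq> Spec R"
    using openin_topspace[of "zariski R"] unfolding openin_zariski by auto
  have "Spec R = {P \<in> Spec R. \<not> carrier R \<subseteq> P}"
  proof -
    have False if "P \<in> Spec R" "carrier R \<subseteq> P" for P
    proof -
      interpret primeideal P R using that by (simp add: Spec_def)
      show False using I_notcarr that a_subset by blast
    qed
    then show ?thesis by blast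
  qed
  then have "openin (zariski R) (Spec R)" unfolding openin_zariski by blast
  then show "Spec R \<subseteq> topspace (zariski R)" by (rule openin_subset)
qed

lemma closedin_zariski:
  "closedin (zariski R) C \<longleftrightarrow> (\<exists>S \<subseteq> carrier R. C = {P \<in> Spec R. S \<subseteq> P})"
proof
  assume C: "closedin (zariski R) C"
  then obtain S where "S \<subseteq> carrier R" "Spec R - C = {P \<in> Spec R. \<not> S \<subseteq> P}" "C \<subseteq> Spec R"
    unfolding closedin_def openin_zariski topspace_zariski by blast
  then show "\<exists>S \<subseteq> carrier R. C = {P \<in> Spec R. S \<subseteq> P}" by (intro exI[of _ S]) blast
next
  assume "\<exists>S \<subseteq> carrier R. C = {P \<in> Spec R. S \<subseteq> P}"
  then obtain S where S: "S \<subseteq> carrier R" "C = {P \<in> Spec R. S \<subseteq> P}" by blast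
  then have "Spec R - C = {P \<in> Spec R. \<not> S \<subseteq> P}" by blast
  with S show "closedin (zariski R) C"
    unfolding closedin_def openin_zariski topspace_zariski by blast
qed

definition max_topology :: "('a, 'm) ring_scheme \<Rightarrow> 'a set topology"
  where "max_topology R = subtopology (zariski R) (Max_Spec R)"

definition pm_ring :: "('a, 'm) ring_scheme \<Rightarrow> bool"
  where "pm_ring R \<longleftrightarrow> cring R \<and> (\<forall>P \<in> Spec R. \<exists>!M. M \<in> Max_Spec R \<and> P \<subseteq> M)"

text \<open>The retraction \<open>\<mu>\<close> of \<open>Spec R\<close> onto \<open>Max R\<close>, meaningful for pm-rings.\<close>

definition max_retraction :: "('a, 'm) ring_scheme \<Rightarrow> 'a set \<Rightarrow> 'a set"
  where "max_retraction R P = (THE M. M \<in> Max_Spec R \<and> P \<subseteq> M)"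

lemma max_retraction:
  assumes "pm_ring R" "P \<in> Spec R"
  shows "max_retraction R P \<in> Max_Spec R" "P \<subseteq> max_retraction R P"
  using theI'[of "\<lambda>M. M \<in> Max_Spec R \<and> P \<subseteq> M"] assms
  unfolding pm_ring_def max_retraction_def by blast+

section \<open>The compact-open topology and the fundamental group\<close>

text \<open>Continuous maps are represented by their extensional representatives, so that two of them
  are equal as soon as they agree on the domain space.\<close>

definition continuous_maps :: "'a topology \<Rightarrow> 'b topology \<Rightarrow> ('a \<Rightarrow> 'b) set"
  where "continuous_maps Y Z = {f \<in> extensional (topspace Y). continuous_map Y Z f}"

definition compact_open :: "'a topology \<Rightarrow> 'b topology \<Rightarrow> ('a \<Rightarrow> 'b) topology"
  where "compact_open Y Z = topology_generated_by
    {{f \<in> continuous_maps Y Z. f ` K \<subseteq> U} | K U. compactin Y K \<and> openin Z U}"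

lemma topspace_compact_open: "topspace (compact_open Y Z) = continuous_maps Y Z"
proof -
  have "continuous_maps Y Z \<in> {{f \<in> continuous_maps Y Z. f ` K \<subseteq> U} | K U. compactin Y K \<and> openin Z U}"
    by (rule CollectI, rule exI[of _ "{}"], rule exI[of _ "topspace Z"]) auto
  then show ?thesis
    unfolding compact_open_def topology_generated_by_topspace by blast
qed

definition loops :: "'a topology \<Rightarrow> 'a \<Rightarrow> (real \<Rightarrow> 'a) set"
  where "loops Y y = {g. pathin Y g \<and> g 0 = y \<and> g 1 = y}"

text \<open>Based homotopy of loops. The values of a loop outside \<open>{0..1}\<close> are irrelevant for it.\<close>

definition loop_homotopy :: "'a topology \<Rightarrow> 'a \<Rightarrow> ((real \<Rightarrow> 'a) \<times> (real \<Rightarrow> 'a)) set"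
  where "loop_homotopy Y y = {(g, h). g \<in> loops Y y \<and> h \<in> loops Y y \<and>
    homotopic_with (\<lambda>k. k 0 = y \<and> k 1 = y) (top_of_set {0..1}) Y g h}"

text \<open>The same function as \<^const>\<open>joinpaths\<close>, without its type class constraint.\<close>

definition loop_concat :: "(real \<Rightarrow> 'a) \<Rightarrow> (real \<Rightarrow> 'a) \<Rightarrow> real \<Rightarrow> 'a"
  where "loop_concat g h = (\<lambda>t. if t \<le> 1/2 then g (2 * t) else h (2 * t - 1))"

definition fundamental_group :: "'a topology \<Rightarrow> 'a \<Rightarrow> (real \<Rightarrow> 'a) set monoid"
  where "fundamental_group Y y =
    \<lparr>carrier = loops Y y // loop_homotopy Y y,
     monoid.mult = (\<lambda>a b. \<Union>g\<in>a. \<Union>h\<in>b. loop_homotopy Y y `` {loop_concat g h}),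
     one = loop_homotopy Y y `` {\<lambda>_. y}\<rparr>"

section \<open>The spectral fundamental group\<close>

text \<open>An \<open>\<real>\<close>-algebra is a ring record extended by a scalar multiplication with real
  scalars.\<close>

definition alg_endomorphisms :: "(real, 'a, 'm) module_scheme \<Rightarrow> ('a \<Rightarrow> 'a) set"
  where "alg_endomorphisms R = {f \<in> ring_hom R R. f \<in> extensional (carrier R) \<and>
    (\<forall>c. \<forall>x \<in> carrier R. f (c \<odot>\<^bsub>R\<^esub> x) = c \<odot>\<^bsub>R\<^esub> f x)}"

definition spectral_map :: "('a, 'm) ring_scheme \<Rightarrow> ('a \<Rightarrow> 'a) \<Rightarrow> 'a set \<Rightarrow> 'a set"
  where "spectral_map R f =
    (\<lambda>M \<in> Max_Spec R. max_retraction R {x \<in> carrier R. f x \<in> M})"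

definition spectral_space :: "(real, 'a, 'm) module_scheme \<Rightarrow> ('a set \<Rightarrow> 'a set) topology"
  where "spectral_space R = subtopology (compact_open (max_topology R) (max_topology R))
    (spectral_map R ` alg_endomorphisms R)"

definition spectral_fundamental_group ::
    "(real, 'a, 'm) module_scheme \<Rightarrow> (real \<Rightarrow> 'a set \<Rightarrow> 'a set) set monoid"
  where "spectral_fundamental_group R =
    fundamental_group (spectral_space R) (spectral_map R (\<lambda>x \<in> carrier R. x))"

section \<open>The algebras\<close>

definition cont_algebra :: "'t topology \<Rightarrow> (real, 't \<Rightarrow> real) module"
  where "cont_algebra T =
    \<lparr>carrier = continuous_maps T euclideanreal,
     monoid.mult = (\<lambda>f g. \<lambda>t \<in> topspace T. f t * g t),
     one = (\<lambda>t \<in> topspace T. 1),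
     zero = (\<lambda>t \<in> topspace T. 0),
     add = (\<lambda>f g. \<lambda>t \<in> topspace T. f t + g t),
     smult = (\<lambda>c f. \<lambda>t \<in> topspace T. c * f t)\<rparr>"

text \<open>Polynomials over \<open>R\<close> in the indeterminates \<open>ring.indexed_var R \<delta>\<close> for \<open>\<delta> \<in> \<Delta>\<close>. Monomials
  are multisets of indices; \<open>ring.indexed_pset R \<Delta> (carrier R)\<close> consists of the finitely supported
  coefficient functions vanishing on monomials not supported in \<open>\<Delta>\<close>.\<close>

definition poly_algebra ::
    "('r, 'a, 'm) module_scheme \<Rightarrow> 'd set \<Rightarrow> ('r, 'd multiset \<Rightarrow> 'a) module"
  where "poly_algebra R \<Delta> =
    \<lparr>carrier = ring.indexed_pset R \<Delta> (carrier R),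
     monoid.mult = (\<lambda>P Q m. \<Oplus>\<^bsub>R\<^esub>k \<in> {k. k \<subseteq># m}. P k \<otimes>\<^bsub>R\<^esub> Q (m - k)),
     one = ring.indexed_const R \<one>\<^bsub>R\<^esub>,
     zero = ring.indexed_const R \<zero>\<^bsub>R\<^esub>,
     add = ring.indexed_padd R,
     smult = (\<lambda>c P m. c \<odot>\<^bsub>R\<^esub> P m)\<rparr>"

definition quotient_algebra :: "('r, 'a, 'm) module_scheme \<Rightarrow> 'a set \<Rightarrow> ('r, 'a set) module"
  where "quotient_algebra R I =
    ring.extend (R Quot I) (module.fields (\<lambda>c C. \<Union>x\<in>C. I +>\<^bsub>R\<^esub> (c \<odot>\<^bsub>R\<^esub> x)))"

definition truncated_poly_algebra ::
    "('r, 'a, 'm) module_scheme \<Rightarrow> 'd set \<Rightarrow> ('d \<Rightarrow> nat) \<Rightarrow> ('r, ('d multiset \<Rightarrow> 'a) set) module"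
  where "truncated_poly_algebra R \<Delta> n =
    (let P = poly_algebra R \<Delta> in
      quotient_algebra P (Idl\<^bsub>P\<^esub> ((\<lambda>\<delta>. ring.indexed_var R \<delta> [^]\<^bsub>P\<^esub> n \<delta>) ` \<Delta>)))"

end

theory Submission
  imports Defs
begin

text \<open>
  The coefficient of the constant monomial defines an algebra homomorphism \<open>\<pi> : A \<rightarrow> B\<close>, and the
  inclusion of the constants defines \<open>\<iota> : B \<rightarrow> A\<close> with \<open>\<pi> \<circ> \<iota> = id\<close>. The kernel of \<open>\<pi>\<close> is generated by
  the nilpotent elements \<open>x\<^sub>\<delta>\<close> and therefore lies in every maximal ideal of \<open>A\<close>, so pulling back along
  \<open>\<pi>\<close> and along \<open>\<iota>\<close> are mutually inverse homeomorphisms between \<open>Max B\<close> and \<open>Max A\<close>.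

  By compactness of \<open>T\<close> every maximal ideal of \<open>B = C(T)\<close> is the ideal of a point, so its residue field
  is \<open>\<real>\<close>; the same then holds for \<open>A\<close>. An \<open>\<real>\<close>-algebra endomorphism \<open>f\<close> fixes the real constants,
  hence \<open>f\<close> followed by reduction modulo a maximal ideal \<open>M\<close> is onto \<open>\<real>\<close>, and \<open>f\<^sup>-\<^sup>1(M)\<close> is already
  maximal: the spectral map \<open>\<mu>\<^sub>f\<close> is just the pullback of maximal ideals along \<open>f\<close>
  (\<open>spectral_map_eq_pullback\<close>). Pullback is functorial, so conjugating with the homeomorphism above sends
  the spectral map of \<open>f \<in> E(B)\<close> to that of \<open>\<iota> \<circ> f \<circ> \<pi> \<in> E(A)\<close>, and the spectral map of \<open>g \<in> E(A)\<close> to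
  that of \<open>\<pi> \<circ> g \<circ> \<iota> \<in> E(B)\<close>. Thus the space of spectral maps of \<open>B\<close> is a retract of that of \<open>A\<close>, with
  identity going to identity, and a loop of spectral maps of \<open>B\<close> that contracts after transport to
  \<open>A\<close> contracts in \<open>B\<close>. This is \<open>spectral_fundamental_group_retract\<close>; the remaining work is to show that
  its hypotheses hold for \<open>C(T)\<close> and for the truncated polynomial algebra over it.
\<close>

section \<open>Triviality of fundamental groups\<close>

lemma equiv_loop_homotopy: "equiv (loops Y y) (loop_homotopy Y y)"
proof (rule equivI)
  show "loop_homotopy Y y \<subseteq> loops Y y \<times> loops Y y"
    by (auto simp: loop_homotopy_def)
  show "refl_on (loops Y y) (loop_homotopy Y y)"
    by (simp add: refl_on_def loop_homotopy_def loops_def pathin_def)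
  show "sym (loop_homotopy Y y)"
    by (rule symI) (simp add: loop_homotopy_def homotopic_with_symD)
  show "trans (loop_homotopy Y y)"
    by (rule transI) (use homotopic_with_trans in \<open>unfold loop_homotopy_def, blast\<close>)
qed

lemma loop_concat_in_loops:
  assumes "g \<in> loops Y y" "h \<in> loops Y y"
  shows "loop_concat g h \<in> loops Y y"
proof -
  let ?I = "top_of_set {0..1::real}"
  have g: "continuous_map ?I Y g" "g 0 = y" "g 1 = y"
    and h: "continuous_map ?I Y h" "h 0 = y" "h 1 = y"
    using assms by (auto simp: loops_def pathin_def)
  have "continuous_map ?I Y (\<lambda>t. if t \<le> 1/2 then (g \<circ> (\<lambda>t. 2 * t)) t else (h \<circ> (\<lambda>t. 2 * t - 1)) t)"
  proof (rule continuous_map_cases_le)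
    show "continuous_map ?I euclideanreal (\<lambda>t. t)" "continuous_map ?I euclideanreal (\<lambda>t. 1/2)"
      by (auto intro: continuous_intros)
    show "continuous_map (subtopology ?I {t \<in> topspace ?I. t \<le> 1/2}) Y (g \<circ> (\<lambda>t. 2 * t))"
      by (rule continuous_map_compose [OF _ g(1)])
        (auto simp: continuous_map_in_subtopology subtopology_subtopology intro!: continuous_intros)
    show "continuous_map (subtopology ?I {t \<in> topspace ?I. 1/2 \<le> t}) Y (h \<circ> (\<lambda>t. 2 * t - 1))"
      by (rule continuous_map_compose [OF _ h(1)])
        (auto simp: continuous_map_in_subtopology subtopology_subtopology intro!: continuous_intros)
    fix t :: real assume "t = 1/2"
    then show "(g \<circ> (\<lambda>t. 2 * t)) t = (h \<circ> (\<lambda>t. 2 * t - 1)) t"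
      unfolding o_def \<open>t = 1/2\<close> by (simp add: g h)
  qed
  then show ?thesis
    using g h unfolding loops_def pathin_def loop_concat_def o_def by simp
qed

text \<open>When every loop is null-homotopic the carrier has a single element, so the group laws reduce to
  the closure of loops under concatenation.\<close>

lemma trivial_fundamental_group_iff:
  assumes y: "y \<in> topspace Y"
  shows "trivial_group (fundamental_group Y y) \<longleftrightarrow>
    (\<forall>g \<in> loops Y y. (g, \<lambda>_. y) \<in> loop_homotopy Y y)"
proof
  have const: "(\<lambda>_. y) \<in> loops Y y"
    using y by (simp add: loops_def pathin_def)
  {
    assume "trivial_group (fundamental_group Y y)"
    then have "loops Y y // loop_homotopy Y y = {loop_homotopy Y y `` {\<lambda>_. y}}"
      by (simp add: trivial_group_def fundamental_group_def)
    then show "\<forall>g \<in> loops Y y. (g, \<lambda>_. y) \<in> loop_homotopy Y y"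
      using const eq_equiv_class[OF _ equiv_loop_homotopy]
      by (metis quotientI singletonD)
  }
  assume *: "\<forall>g \<in> loops Y y. (g, \<lambda>_. y) \<in> loop_homotopy Y y"
  have cls: "loop_homotopy Y y `` {g} = loops Y y" if "g \<in> loops Y y" for g
  proof -
    have "loop_homotopy Y y `` {g} = loop_homotopy Y y `` {\<lambda>_. y}"
      using equiv_class_eq[OF equiv_loop_homotopy] * that by metis
    also have "\<dots> = loops Y y"
      using * equiv_loop_homotopy[of Y y] unfolding equiv_def sym_def by blast
    finally show ?thesis .
  qed
  let ?G = "fundamental_group Y y"
  have carrier: "carrier ?G = {loops Y y}"
    using cls const by (auto simp: quotient_def fundamental_group_def)
  have one: "\<one>\<^bsub>?G\<^esub> = loops Y y"
    using cls const by (simp add: fundamental_group_def)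
  have "(\<Union>g\<in>loops Y y. \<Union>h\<in>loops Y y. loop_homotopy Y y `` {loop_concat g h})
      = (\<Union>g\<in>loops Y y. \<Union>h\<in>loops Y y. loops Y y)"
    by (intro SUP_cong refl cls loop_concat_in_loops)
  then have mult: "loops Y y \<otimes>\<^bsub>?G\<^esub> loops Y y = loops Y y"
    using const by (auto simp: fundamental_group_def)
  have "group ?G"
    by (rule groupI) (simp_all add: carrier one mult)
  then show "trivial_group ?G"
    by (simp add: trivial_group_def carrier one)
qed

text \<open>The map \<open>\<psi>\<close> carries a null-homotopy of \<open>\<phi> \<circ> g\<close> in \<open>Z\<close> to a null-homotopy of \<open>g\<close> in \<open>Y\<close>.\<close>

lemma trivial_fundamental_group_retract:
  assumes \<phi>: "continuous_map Y Z \<phi>" and \<psi>: "continuous_map Z Y \<psi>"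
    and id: "\<And>x. x \<in> topspace Y \<Longrightarrow> \<psi> (\<phi> x) = x"
    and y: "y \<in> topspace Y" and Z: "trivial_group (fundamental_group Z (\<phi> y))"
  shows "trivial_group (fundamental_group Y y)"
  unfolding trivial_fundamental_group_iff[OF y]
proof
  fix g assume g: "g \<in> loops Y y"
  let ?I = "top_of_set {0..1::real}"
  let ?P = "\<lambda>k. k 0 = y \<and> k 1 = y"
  have "\<phi> y \<in> topspace Z" using \<phi> y by (auto simp: continuous_map_def)
  moreover have "\<phi> \<circ> g \<in> loops Z (\<phi> y)"
    using g pathin_compose[OF _ \<phi>] by (simp add: loops_def)
  ultimately have "homotopic_with (\<lambda>k. k 0 = \<phi> y \<and> k 1 = \<phi> y) ?I Z (\<phi> \<circ> g) (\<lambda>_. \<phi> y)"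
    using Z by (simp add: trivial_fundamental_group_iff loop_homotopy_def)
  then have "homotopic_with ?P ?I Y (\<psi> \<circ> (\<phi> \<circ> g)) (\<psi> \<circ> (\<lambda>_. \<phi> y))"
    by (rule homotopic_with_compose_continuous_map_left[OF _ \<psi>]) (simp add: id y)
  then have null: "homotopic_with ?P ?I Y (\<psi> \<circ> (\<phi> \<circ> g)) (\<lambda>_. y)"
    using id y by (simp add: o_def)
  have "homotopic_with ?P ?I Y g (\<psi> \<circ> (\<phi> \<circ> g))"
  proof (rule homotopic_with_equal)
    show "continuous_map ?I Y g" "g 0 = y \<and> g 1 = y"
      using g by (auto simp: loops_def pathin_def)
    then have "g t \<in> topspace Y" if "t \<in> {0..1}" for t
      using that by (auto simp: continuous_map_def Pi_iff)
    then show "g t = (\<psi> \<circ> (\<phi> \<circ> g)) t" if "t \<in> topspace ?I" for t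
      using that id by simp
    show "(\<psi> \<circ> (\<phi> \<circ> g)) 0 = y \<and> (\<psi> \<circ> (\<phi> \<circ> g)) 1 = y"
      using g id y by (simp add: loops_def)
  qed
  then have "homotopic_with ?P ?I Y g (\<lambda>_. y)"
    using null by (rule homotopic_with_trans)
  then show "(g, \<lambda>_. y) \<in> loop_homotopy Y y"
    using g y by (auto simp: loop_homotopy_def loops_def pathin_def)
qed

text \<open>The preimage of the subbasic set of maps taking \<open>K\<close> into \<open>U\<close> is again subbasic: it consists of the
  maps taking \<open>a(K)\<close> into the preimage of \<open>U\<close> under \<open>b\<close>.\<close>

lemma continuous_map_compact_open_compose:
  assumes a: "continuous_map Y' Y a" and b: "continuous_map Z Z' b"
  shows "continuous_map (compact_open Y Z) (compact_open Y' Z')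
    (\<lambda>k. \<lambda>x \<in> topspace Y'. b (k (a x)))" (is "continuous_map _ _ ?F")
proof -
  have into: "?F k \<in> continuous_maps Y' Z'" if "k \<in> continuous_maps Y Z" for k
  proof -
    have "continuous_map Y' Z' (b \<circ> (k \<circ> a))"
      using that a b by (intro continuous_map_compose) (auto simp: continuous_maps_def)
    then have "continuous_map Y' Z' (?F k)"
      by (rule continuous_map_eq) auto
    then show ?thesis by (simp add: continuous_maps_def)
  qed
  show ?thesis
    unfolding compact_open_def [of Y' Z']
  proof (rule continuous_on_generated_topo)
    fix W assume "W \<in> {{f \<in> continuous_maps Y' Z'. f ` K \<subseteq> U} | K U. compactin Y' K \<and> openin Z' U}"
    then obtain K U where W: "W = {f \<in> continuous_maps Y' Z'. f ` K \<subseteq> U}"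
      and K: "compactin Y' K" and U: "openin Z' U" by blast
    have K': "compactin Y (a ` K)" using image_compactin[OF K a] .
    have U': "openin Z {z \<in> topspace Z. b z \<in> U}"
      using openin_continuous_map_preimage[OF b U] .
    have "K \<subseteq> topspace Y'" using compactin_subset_topspace[OF K] .
    then have "?F -` W \<inter> topspace (compact_open Y Z)
        = {f \<in> continuous_maps Y Z. f ` (a ` K) \<subseteq> {z \<in> topspace Z. b z \<in> U}}"
    proof -
      have "?F k \<in> W \<longleftrightarrow> k ` (a ` K) \<subseteq> {z \<in> topspace Z. b z \<in> U}" if "k \<in> continuous_maps Y Z" for k
      proof -
        have "k (a x) \<in> topspace Z" if "x \<in> K" for x
          using that \<open>K \<subseteq> topspace Y'\<close> \<open>k \<in> _\<close> a
          by (auto simp: continuous_maps_def continuous_map_def Pi_iff)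
        moreover have "?F k x = b (k (a x))" if "x \<in> K" for x
          using that \<open>K \<subseteq> topspace Y'\<close> by auto
        ultimately show ?thesis
          using into[OF that] unfolding W image_subset_iff by simp
      qed
      then show ?thesis unfolding topspace_compact_open by blast
    qed
    then show "openin (compact_open Y Z) (?F -` W \<inter> topspace (compact_open Y Z))"
      using K' U' unfolding compact_open_def by (blast intro: topology_generated_by_Basis)
  next
    have "?F ` topspace (compact_open Y Z) \<subseteq> topspace (compact_open Y' Z')"
      using into by (auto simp: topspace_compact_open)
    then show "?F ` topspace (compact_open Y Z)
      \<subseteq> \<Union> {{f \<in> continuous_maps Y' Z'. f ` K \<subseteq> U} | K U. compactin Y' K \<and> openin Z' U}"
      unfolding compact_open_def [of Y' Z'] topology_generated_by_topspace .
  qed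
qed

section \<open>Maximal ideals under ring homomorphisms\<close>

definition alg_hom :: "('r, 'a, 'm) module_scheme \<Rightarrow> ('r, 'b, 'n) module_scheme \<Rightarrow> ('a \<Rightarrow> 'b) set"
  where "alg_hom R S = {f \<in> ring_hom R S. \<forall>c. \<forall>x \<in> carrier R. f (c \<odot>\<^bsub>R\<^esub> x) = c \<odot>\<^bsub>S\<^esub> f x}"

definition pullback :: "('a, 'm) ring_scheme \<Rightarrow> ('a \<Rightarrow> 'b) \<Rightarrow> 'b set \<Rightarrow> 'a set"
  where "pullback R f M = {x \<in> carrier R. f x \<in> M}"

text \<open>The residue ring is a field: \<open>I\<close> and \<open>a\<close> together generate the unit ideal.\<close>

lemma (in maximalideal) inverse_mod:
  assumes "cring R" "a \<in> carrier R" "a \<notin> I"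
  obtains z where "z \<in> carrier R" "\<one> \<ominus> z \<otimes> a \<in> I"
proof -
  interpret cring R by fact
  let ?J = "I <+>\<^bsub>R\<^esub> (PIdl\<^bsub>R\<^esub> a)"
  have J: "ideal ?J R"
    by (intro add_ideals is_ideal cgenideal_ideal assms)
  have "\<zero> \<in> PIdl\<^bsub>R\<^esub> a"
    using additive_subgroup.zero_closed[OF ideal.axioms(1)[OF cgenideal_ideal[OF assms(2)]]] .
  moreover have sum: "i \<oplus> j \<in> ?J" if "i \<in> I" "j \<in> PIdl\<^bsub>R\<^esub> a" for i j
    using that unfolding set_add_def' by blast
  ultimately have sum0: "i \<oplus> \<zero> \<in> ?J" if "i \<in> I" for i
    using that by blast
  have "\<zero> \<oplus> a \<in> ?J"
    by (intro sum cgenideal_self assms(2)) simp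
  then have "a \<in> ?J" using assms(2) by simp
  moreover have "I \<subseteq> ?J"
  proof
    fix i assume "i \<in> I"
    then show "i \<in> ?J" using sum0[of i] Icarr[of i] by simp
  qed
  ultimately have "?J = carrier R"
    using I_maximal[OF J] assms(3) ideal.Icarr[OF J] by blast
  then have "\<one> \<in> ?J" by simp
  then obtain i z where iz: "i \<in> I" "z \<in> carrier R" "\<one> = i \<oplus> z \<otimes> a"
    unfolding set_add_def' cgenideal_def by blast
  then have "\<one> \<ominus> z \<otimes> a = i"
    using Icarr[OF iz(1)] assms(2) by (simp add: a_minus_def a_assoc r_neg)
  then show thesis using that iz by blast
qed

text \<open>The composite \<open>R \<rightarrow> S \<rightarrow> S/M\<close> maps onto a field, so its kernel is maximal. Asking for surjectivity
  only modulo \<open>M\<close> makes this apply to surjections, to the inclusion of constants into an algebra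
  that is generated over them by nilpotents, and to endomorphisms of algebras with residue field
  \<open>\<real>\<close>.\<close>

lemma pullback_maximalideal:
  assumes R: "cring R" and S: "cring S" and f: "f \<in> ring_hom R S" and M: "maximalideal M S"
    and surj: "\<And>y. y \<in> carrier S \<Longrightarrow> \<exists>x \<in> carrier R. y \<ominus>\<^bsub>S\<^esub> f x \<in> M"
  shows "maximalideal (pullback R f M) R"
proof -
  interpret R: cring R by fact
  interpret S: cring S by fact
  interpret M: maximalideal M S by fact
  interpret f: ring_hom_ring R S f
    using ring_hom_ringI2[OF R.ring_axioms S.ring_axioms f] .
  let ?J = "pullback R f M"
  have J: "ideal ?J R"
    unfolding pullback_def by (rule f.ideal_vimage) (rule M.is_ideal)
  have "\<one>\<^bsub>R\<^esub> \<notin> ?J"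
    using M.one_imp_carrier M.I_notcarr by (auto simp: pullback_def)
  show ?thesis
  proof (rule maximalidealI[OF J])
    show "carrier R \<noteq> ?J" using \<open>\<one>\<^bsub>R\<^esub> \<notin> ?J\<close> by blast
    fix K assume K: "ideal K R" "?J \<subseteq> K" "K \<subseteq> carrier R"
    interpret K: ideal K R by fact
    show "K = ?J \<or> K = carrier R"
    proof (rule disjCI)
      assume "K \<noteq> carrier R"
      show "K = ?J"
      proof (rule ccontr)
        assume "K \<noteq> ?J"
        then obtain x where x: "x \<in> K" "x \<notin> ?J" using K by blast
        then have xR: "x \<in> carrier R" and "f x \<notin> M" using K by (auto simp: pullback_def)
        obtain z where z: "z \<in> carrier S" "\<one>\<^bsub>S\<^esub> \<ominus>\<^bsub>S\<^esub> z \<otimes>\<^bsub>S\<^esub> f x \<in> M"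
          using M.inverse_mod[OF S _ \<open>f x \<notin> M\<close>] xR by auto
        obtain w where w: "w \<in> carrier R" "z \<ominus>\<^bsub>S\<^esub> f w \<in> M"
          using surj[OF z(1)] by blast
        \<comment> \<open>\<open>z\<close> inverts \<open>f x\<close> modulo \<open>M\<close> and \<open>f w\<close> represents \<open>z\<close>, so \<open>w\<close> inverts \<open>x\<close> modulo the pullback.\<close>
        have "f (\<one>\<^bsub>R\<^esub> \<ominus>\<^bsub>R\<^esub> w \<otimes>\<^bsub>R\<^esub> x)
          = (\<one>\<^bsub>S\<^esub> \<ominus>\<^bsub>S\<^esub> z \<otimes>\<^bsub>S\<^esub> f x) \<oplus>\<^bsub>S\<^esub> (z \<ominus>\<^bsub>S\<^esub> f w) \<otimes>\<^bsub>S\<^esub> f x"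
        proof -
          have "f w \<in> carrier S" "f x \<in> carrier S" using w xR by auto
          then have "\<one>\<^bsub>S\<^esub> \<ominus>\<^bsub>S\<^esub> f w \<otimes>\<^bsub>S\<^esub> f x
            = (\<one>\<^bsub>S\<^esub> \<ominus>\<^bsub>S\<^esub> z \<otimes>\<^bsub>S\<^esub> f x) \<oplus>\<^bsub>S\<^esub> (z \<ominus>\<^bsub>S\<^esub> f w) \<otimes>\<^bsub>S\<^esub> f x"
            using z by algebra
          then show ?thesis
            using w xR by (simp add: a_minus_def)
        qed
        also have "\<dots> \<in> M"
          using z w xR by (intro M.a_closed M.I_r_closed) auto
        finally have "\<one>\<^bsub>R\<^esub> \<ominus>\<^bsub>R\<^esub> w \<otimes>\<^bsub>R\<^esub> x \<in> K"
          using w xR K(2) by (auto simp: pullback_def)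
        then have "(\<one>\<^bsub>R\<^esub> \<ominus>\<^bsub>R\<^esub> w \<otimes>\<^bsub>R\<^esub> x) \<oplus>\<^bsub>R\<^esub> w \<otimes>\<^bsub>R\<^esub> x \<in> K"
          using w x by (intro K.a_closed K.I_l_closed) auto
        also have "(\<one>\<^bsub>R\<^esub> \<ominus>\<^bsub>R\<^esub> w \<otimes>\<^bsub>R\<^esub> x) \<oplus>\<^bsub>R\<^esub> w \<otimes>\<^bsub>R\<^esub> x = \<one>\<^bsub>R\<^esub>"
          using w xR by algebra
        finally show False
          using K.one_imp_carrier \<open>K \<noteq> carrier R\<close> by blast
      qed
    qed
  qed
qed

lemma (in cring) Max_Spec_subset_Spec: "Max_Spec R \<subseteq> Spec R"
  using maximalideal_prime by (auto simp: Max_Spec_def Spec_def)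

lemma (in cring) topspace_max_topology: "topspace (max_topology R) = Max_Spec R"
  using Max_Spec_subset_Spec by (auto simp: max_topology_def topspace_zariski)

lemma (in cring) openin_max_topology:
  "openin (max_topology R) U \<longleftrightarrow> (\<exists>S \<subseteq> carrier R. U = {M \<in> Max_Spec R. \<not> S \<subseteq> M})"
proof -
  have "{P \<in> Spec R. \<not> S \<subseteq> P} \<inter> Max_Spec R = {M \<in> Max_Spec R. \<not> S \<subseteq> M}" for S
    using Max_Spec_subset_Spec by blast
  then show ?thesis
    unfolding max_topology_def openin_subtopology openin_zariski by auto
qed

text \<open>For a subset \<open>A\<close> of \<open>R\<close>, the pullback of \<open>M\<close> omits an element of \<open>A\<close> if and only if \<open>M\<close> omits an
  element of \<open>f(A)\<close>; so preimages of open sets are open.\<close>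

lemma continuous_map_pullback:
  assumes R: "cring R" and S: "cring S" and f: "f \<in> ring_hom R S"
    and M: "\<And>M. M \<in> Max_Spec S \<Longrightarrow> pullback R f M \<in> Max_Spec R"
  shows "continuous_map (max_topology S) (max_topology R) (pullback R f)"
  unfolding continuous_map_def cring.topspace_max_topology[OF R] cring.topspace_max_topology[OF S]
proof (intro conjI allI impI)
  show "pullback R f \<in> Max_Spec S \<rightarrow> Max_Spec R" using M by blast
  fix U assume "openin (max_topology R) U"
  then obtain A where A: "A \<subseteq> carrier R" "U = {M \<in> Max_Spec R. \<not> A \<subseteq> M}"
    unfolding cring.openin_max_topology[OF R] by blast
  have "{M \<in> Max_Spec S. pullback R f M \<in> U} = {M \<in> Max_Spec S. \<not> f ` A \<subseteq> M}"
  proof -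
    have "pullback R f M \<in> U \<longleftrightarrow> \<not> f ` A \<subseteq> M" if "M \<in> Max_Spec S" for M
      using A M[OF that] by (auto simp: pullback_def)
    then show ?thesis by blast
  qed
  moreover have "f ` A \<subseteq> carrier S" using A ring_hom_closed[OF f] by blast
  ultimately show "openin (max_topology S) {M \<in> Max_Spec S. pullback R f M \<in> U}"
    unfolding cring.openin_max_topology[OF S] by blast
qed

section \<open>Spectral maps of real algebras\<close>

text \<open>For an algebra \<open>R\<close> this says that \<open>\<real> \<rightarrow> R/M\<close> is onto, hence an isomorphism, for every maximal ideal
  \<open>M\<close>.\<close>

definition real_residues :: "(real, 'a, 'm) module_scheme \<Rightarrow> bool"
  where "real_residues R \<longleftrightarrow> (\<forall>M \<in> Max_Spec R. \<forall>x \<in> carrier R. \<exists>c.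
    c \<odot>\<^bsub>R\<^esub> \<one>\<^bsub>R\<^esub> \<in> carrier R \<and> x \<ominus>\<^bsub>R\<^esub> c \<odot>\<^bsub>R\<^esub> \<one>\<^bsub>R\<^esub> \<in> M)"

lemma alg_endomorphisms_subset: "alg_endomorphisms R \<subseteq> alg_hom R R"
  by (auto simp: alg_endomorphisms_def alg_hom_def)

lemma restrict_alg_hom:
  fixes R :: "(real, 'a, 'm) module_scheme"
  assumes "ring R" "\<And>c x. x \<in> carrier R \<Longrightarrow> c \<odot>\<^bsub>R\<^esub> x \<in> carrier R" "f \<in> alg_hom R R"
  shows "restrict f (carrier R) \<in> alg_endomorphisms R"
proof -
  interpret ring R by fact
  show ?thesis
    using assms by (simp add: alg_endomorphisms_def alg_hom_def ring_hom_def Pi_iff)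
qed

lemma alg_hom_compose:
  assumes "f \<in> alg_hom R S" "g \<in> alg_hom S Q"
  shows "g \<circ> f \<in> alg_hom R Q"
proof -
  have f: "f \<in> ring_hom R S" and g: "g \<in> ring_hom S Q"
    using assms by (auto simp: alg_hom_def)
  then show ?thesis
    using assms ring_hom_trans[OF f g] ring_hom_closed[OF f] by (simp add: alg_hom_def)
qed

text \<open>Every residue class modulo \<open>M\<close> contains a real constant, and \<open>f\<close> fixes the constants; so \<open>f\<close> is onto
  modulo \<open>M\<close>.\<close>

lemma pullback_endomorphism:
  assumes R: "cring R" and res: "real_residues R"
    and f: "f \<in> alg_hom R R" and M: "M \<in> Max_Spec R"
  shows "pullback R f M \<in> Max_Spec R"
proof -
  have "f \<in> ring_hom R R" using f by (simp add: alg_hom_def)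
  moreover have "\<exists>x \<in> carrier R. y \<ominus>\<^bsub>R\<^esub> f x \<in> M" if y: "y \<in> carrier R" for y
  proof -
    obtain c where c: "c \<odot>\<^bsub>R\<^esub> \<one>\<^bsub>R\<^esub> \<in> carrier R" "y \<ominus>\<^bsub>R\<^esub> c \<odot>\<^bsub>R\<^esub> \<one>\<^bsub>R\<^esub> \<in> M"
      using res[unfolded real_residues_def, rule_format, OF M y] by auto
    have "f (c \<odot>\<^bsub>R\<^esub> \<one>\<^bsub>R\<^esub>) = c \<odot>\<^bsub>R\<^esub> \<one>\<^bsub>R\<^esub>"
      using f ring_hom_one[of f R R] cring.cring_simprules(6)[OF R] by (simp add: alg_hom_def)
    then show ?thesis using c by metis
  qed
  ultimately show ?thesis
    using pullback_maximalideal[OF R R] M by (auto simp: Max_Spec_def)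
qed

lemma max_retraction_eq_self:
  assumes "M \<in> Max_Spec R"
  shows "max_retraction R M = M"
  unfolding max_retraction_def
proof (rule the_equality)
  fix N assume N: "N \<in> Max_Spec R \<and> M \<subseteq> N"
  interpret M: maximalideal M R using assms by (simp add: Max_Spec_def)
  interpret N: maximalideal N R using N by (simp add: Max_Spec_def)
  show "N = M"
    using M.I_maximal[OF N.is_ideal] N N.I_notcarr N.a_subset by auto
qed (use assms in simp)

text \<open>The pullback of a maximal ideal is already maximal, and the retraction fixes maximal ideals.\<close>

lemma spectral_map_eq_pullback:
  assumes "cring R" "real_residues R" "f \<in> alg_hom R R"
  shows "spectral_map R f = restrict (pullback R f) (Max_Spec R)"
proof -
  have "max_retraction R (pullback R f M) = pullback R f M" if "M \<in> Max_Spec R" for M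
    using max_retraction_eq_self[OF pullback_endomorphism[OF assms that]] .
  then show ?thesis
    unfolding spectral_map_def pullback_def by (intro restrict_ext)
qed

lemma identity_alg_endomorphism:
  fixes R :: "(real, 'a, 'm) module_scheme"
  assumes "cring R" and "\<And>c x. x \<in> carrier R \<Longrightarrow> c \<odot>\<^bsub>R\<^esub> x \<in> carrier R"
  shows "(\<lambda>x \<in> carrier R. x) \<in> alg_endomorphisms R"
proof -
  interpret cring R by fact
  show ?thesis
    using assms(2) by (simp add: alg_endomorphisms_def ring_hom_def)
qed

lemma spectral_map_id:
  fixes R :: "(real, 'a, 'm) module_scheme"
  assumes R: "cring R" and smult: "\<And>c x. x \<in> carrier R \<Longrightarrow> c \<odot>\<^bsub>R\<^esub> x \<in> carrier R"
    and res: "real_residues R"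
  shows "spectral_map R (\<lambda>x \<in> carrier R. x) = (\<lambda>M \<in> Max_Spec R. M)"
proof -
  have "pullback R (\<lambda>x \<in> carrier R. x) M = M" if "M \<in> Max_Spec R" for M
    using that
    by (auto simp: pullback_def Max_Spec_def maximalideal_def ideal_def dest: additive_subgroup.a_subset)
  moreover have "(\<lambda>x \<in> carrier R. x) \<in> alg_hom R R"
    using alg_endomorphisms_subset identity_alg_endomorphism[OF R smult] by (rule subsetD)
  ultimately show ?thesis
    by (simp add: spectral_map_eq_pullback[OF R res] cong: restrict_cong)
qed

text \<open>Conjugation with the bijections of maximal spectra induced by \<open>\<pi>\<close> and \<open>\<iota>\<close> makes the spectral
  space of \<open>S\<close> a retract of that of \<open>R\<close>. The hypothesis \<open>ker\<close> says that the kernel of \<open>\<pi>\<close> lies in the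
  Jacobson radical: it makes \<open>\<iota>\<close> surjective modulo every maximal ideal of \<open>R\<close>, and it makes the
  conjugate of the identity the identity, so that base points correspond.\<close>

lemma spectral_fundamental_group_retract:
  fixes R :: "(real, 'a, 'm) module_scheme" and S :: "(real, 'b, 'n) module_scheme"
  assumes R: "cring R" and S: "cring S"
    and smult_R: "\<And>c x. x \<in> carrier R \<Longrightarrow> c \<odot>\<^bsub>R\<^esub> x \<in> carrier R"
    and smult_S: "\<And>c x. x \<in> carrier S \<Longrightarrow> c \<odot>\<^bsub>S\<^esub> x \<in> carrier S"
    and \<pi>: "\<pi> \<in> alg_hom R S" and \<iota>: "\<iota> \<in> alg_hom S R"
    and sect: "\<And>b. b \<in> carrier S \<Longrightarrow> \<pi> (\<iota> b) = b"
    and ker: "\<And>M x. M \<in> Max_Spec R \<Longrightarrow> x \<in> carrier R \<Longrightarrow> \<pi> x = \<zero>\<^bsub>S\<^esub> \<Longrightarrow> x \<in> M"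
    and res_S: "real_residues S"
    and trivial: "trivial_group (spectral_fundamental_group R)"
  shows "trivial_group (spectral_fundamental_group S)"
proof -
  interpret R: cring R by fact
  interpret S: cring S by fact
  have \<pi>_hom: "\<pi> \<in> ring_hom R S" and \<iota>_hom: "\<iota> \<in> ring_hom S R"
    using \<pi> \<iota> unfolding alg_hom_def by blast+
  interpret \<pi>: ring_hom_ring R S \<pi>
    using ring_hom_ringI2[OF R.ring_axioms S.ring_axioms \<pi>_hom] .
  interpret \<iota>: ring_hom_ring S R \<iota>
    using ring_hom_ringI2[OF S.ring_axioms R.ring_axioms \<iota>_hom] .
  let ?p = "pullback R \<pi>" and ?i = "pullback S \<iota>"
  have mod_ker: "x \<ominus>\<^bsub>R\<^esub> \<iota> (\<pi> x) \<in> M" if "x \<in> carrier R" "M \<in> Max_Spec R" for x M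
    using that by (auto intro!: ker[OF that(2)] simp: a_minus_def sect S.r_neg)
  have p_max: "?p N \<in> Max_Spec R" if "N \<in> Max_Spec S" for N
  proof -
    have "\<exists>x \<in> carrier R. y \<ominus>\<^bsub>S\<^esub> \<pi> x \<in> N" if "y \<in> carrier S" for y
    proof
      have "\<zero>\<^bsub>S\<^esub> \<in> N"
        using \<open>N \<in> Max_Spec S\<close> by (simp add: Max_Spec_def maximalideal_def ideal_def additive_subgroup.zero_closed)
      then show "y \<ominus>\<^bsub>S\<^esub> \<pi> (\<iota> y) \<in> N"
        using that by (simp add: sect a_minus_def S.r_neg)
    qed (use that in simp)
    then show ?thesis
      using pullback_maximalideal[OF R S \<pi>_hom] that by (simp add: Max_Spec_def)
  qed
  have i_max: "?i M \<in> Max_Spec S" if "M \<in> Max_Spec R" for M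
  proof -
    have "\<exists>x \<in> carrier S. y \<ominus>\<^bsub>R\<^esub> \<iota> x \<in> M" if "y \<in> carrier R" for y
      using mod_ker[OF that \<open>M \<in> Max_Spec R\<close>] \<pi>.hom_closed[OF that] by (rule rev_bexI[rotated])
    then show ?thesis
      using pullback_maximalideal[OF S R \<iota>_hom] that by (simp add: Max_Spec_def)
  qed
  have ip_pull: "?i (?p N) = N" if "N \<in> Max_Spec S" for N
  proof -
    have "N \<subseteq> carrier S"
      using that by (auto simp: Max_Spec_def maximalideal_def ideal_def dest: additive_subgroup.a_subset)
    then show ?thesis by (auto simp: pullback_def sect)
  qed
  have pi_pull: "?p (?i M) = M" if M: "M \<in> Max_Spec R" for M
  proof -
    interpret M: maximalideal M R using M by (simp add: Max_Spec_def)
    have "\<iota> (\<pi> x) \<in> M \<longleftrightarrow> x \<in> M" if x: "x \<in> carrier R" for x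
    proof
      assume "\<iota> (\<pi> x) \<in> M"
      then have "(x \<ominus>\<^bsub>R\<^esub> \<iota> (\<pi> x)) \<oplus>\<^bsub>R\<^esub> \<iota> (\<pi> x) \<in> M"
        using mod_ker[OF x M] M.a_closed by blast
      then show "x \<in> M"
        using x by (simp add: a_minus_def R.a_assoc R.l_neg)
    next
      assume "x \<in> M"
      then have "x \<oplus>\<^bsub>R\<^esub> \<ominus>\<^bsub>R\<^esub> (x \<ominus>\<^bsub>R\<^esub> \<iota> (\<pi> x)) \<in> M"
        using mod_ker[OF x M] M.a_closed M.a_inv_closed by blast
      moreover have "\<iota> (\<pi> x) \<in> carrier R" using x by simp
      then have "x \<oplus>\<^bsub>R\<^esub> \<ominus>\<^bsub>R\<^esub> (x \<ominus>\<^bsub>R\<^esub> \<iota> (\<pi> x)) = \<iota> (\<pi> x)"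
        using x by algebra
      ultimately show "\<iota> (\<pi> x) \<in> M" by simp
    qed
    then show ?thesis using M.a_subset by (auto simp: pullback_def)
  qed
  \<comment> \<open>A real constant congruent to \<open>\<pi> x\<close> modulo the pullback of \<open>M\<close> to \<open>S\<close> is congruent to \<open>x\<close> modulo \<open>M\<close>.\<close>
  have res_R: "real_residues R"
    unfolding real_residues_def
  proof (intro ballI)
    fix M x assume M: "M \<in> Max_Spec R" and x: "x \<in> carrier R"
    obtain c where c: "c \<odot>\<^bsub>S\<^esub> \<one>\<^bsub>S\<^esub> \<in> carrier S" "\<pi> x \<ominus>\<^bsub>S\<^esub> c \<odot>\<^bsub>S\<^esub> \<one>\<^bsub>S\<^esub> \<in> ?i M"
      using res_S[unfolded real_residues_def, rule_format, OF i_max[OF M] \<pi>.hom_closed[OF x]] by auto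
    have c1: "c \<odot>\<^bsub>R\<^esub> \<one>\<^bsub>R\<^esub> \<in> carrier R" using smult_R by simp
    have "\<pi> (x \<ominus>\<^bsub>R\<^esub> c \<odot>\<^bsub>R\<^esub> \<one>\<^bsub>R\<^esub>) = \<pi> x \<ominus>\<^bsub>S\<^esub> c \<odot>\<^bsub>S\<^esub> \<one>\<^bsub>S\<^esub>"
      using x c1 \<pi> by (simp add: a_minus_def alg_hom_def)
    then have "x \<ominus>\<^bsub>R\<^esub> c \<odot>\<^bsub>R\<^esub> \<one>\<^bsub>R\<^esub> \<in> ?p (?i M)"
      using c x c1 by (simp add: pullback_def)
    then show "\<exists>c. c \<odot>\<^bsub>R\<^esub> \<one>\<^bsub>R\<^esub> \<in> carrier R \<and> x \<ominus>\<^bsub>R\<^esub> c \<odot>\<^bsub>R\<^esub> \<one>\<^bsub>R\<^esub> \<in> M"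
      using c1 pi_pull[OF M] by auto
  qed
  \<comment> \<open>\<open>?i\<close> and \<open>?p\<close> are mutually inverse, so \<open>\<phi>\<close> and \<open>\<psi>\<close> are conjugations of self-maps.\<close>
  note topR = R.topspace_max_topology and topS = S.topspace_max_topology
  define \<phi> where "\<phi> k = (\<lambda>M \<in> Max_Spec R. ?p (k (?i M)))" for k
  define \<psi> where "\<psi> k = (\<lambda>N \<in> Max_Spec S. ?i (k (?p N)))" for k
  have cont_p: "continuous_map (max_topology S) (max_topology R) ?p"
    using continuous_map_pullback[OF R S \<pi>_hom p_max] .
  have cont_i: "continuous_map (max_topology R) (max_topology S) ?i"
    using continuous_map_pullback[OF S R \<iota>_hom i_max] .
  have \<phi>_spec: "\<phi> (spectral_map S f) = spectral_map R (restrict (\<iota> \<circ> f \<circ> \<pi>) (carrier R))"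
    "restrict (\<iota> \<circ> f \<circ> \<pi>) (carrier R) \<in> alg_endomorphisms R"
    if f: "f \<in> alg_endomorphisms S" for f
  proof -
    have f': "f \<in> alg_hom S S" using f alg_endomorphisms_subset by blast
    have comp: "\<iota> \<circ> f \<circ> \<pi> \<in> alg_hom R R"
      by (intro alg_hom_compose[OF \<pi>] alg_hom_compose[OF f' \<iota>])
    show E: "restrict (\<iota> \<circ> f \<circ> \<pi>) (carrier R) \<in> alg_endomorphisms R"
      using restrict_alg_hom[OF R.ring_axioms smult_R comp] .
    have "?p (pullback S f (?i M)) = pullback R (restrict (\<iota> \<circ> f \<circ> \<pi>) (carrier R)) M" for M
      using f' by (auto simp: pullback_def alg_hom_def ring_hom_closed)
    then show "\<phi> (spectral_map S f) = spectral_map R (restrict (\<iota> \<circ> f \<circ> \<pi>) (carrier R))"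
      unfolding \<phi>_def spectral_map_eq_pullback[OF S res_S f']
        spectral_map_eq_pullback[OF R res_R subsetD[OF alg_endomorphisms_subset E]]
      by (intro restrict_ext) (simp add: i_max)
  qed
  have \<psi>_spec: "\<psi> (spectral_map R f) = spectral_map S (restrict (\<pi> \<circ> f \<circ> \<iota>) (carrier S))"
    "restrict (\<pi> \<circ> f \<circ> \<iota>) (carrier S) \<in> alg_endomorphisms S"
    if f: "f \<in> alg_endomorphisms R" for f
  proof -
    have f': "f \<in> alg_hom R R" using f alg_endomorphisms_subset by blast
    have comp: "\<pi> \<circ> f \<circ> \<iota> \<in> alg_hom S S"
      by (intro alg_hom_compose[OF \<iota>] alg_hom_compose[OF f' \<pi>])
    show E: "restrict (\<pi> \<circ> f \<circ> \<iota>) (carrier S) \<in> alg_endomorphisms S"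
      using restrict_alg_hom[OF S.ring_axioms smult_S comp] .
    have "?i (pullback R f (?p M)) = pullback S (restrict (\<pi> \<circ> f \<circ> \<iota>) (carrier S)) M" for M
      using f' by (auto simp: pullback_def alg_hom_def ring_hom_closed)
    then show "\<psi> (spectral_map R f) = spectral_map S (restrict (\<pi> \<circ> f \<circ> \<iota>) (carrier S))"
      unfolding \<psi>_def spectral_map_eq_pullback[OF R res_R f']
        spectral_map_eq_pullback[OF S res_S subsetD[OF alg_endomorphisms_subset E]]
      by (intro restrict_ext) (simp add: p_max)
  qed
  have cont_\<phi>: "continuous_map (spectral_space S) (spectral_space R) \<phi>"
    unfolding spectral_space_def
  proof (rule continuous_map_into_subtopology)
    show "continuous_map (subtopology (compact_open (max_topology S) (max_topology S))
        (spectral_map S ` alg_endomorphisms S)) (compact_open (max_topology R) (max_topology R)) \<phi>"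
      using continuous_map_compact_open_compose[OF cont_i cont_p]
      unfolding topR \<phi>_def by (rule continuous_map_from_subtopology)
    show "\<phi> \<in> topspace (subtopology (compact_open (max_topology S) (max_topology S))
        (spectral_map S ` alg_endomorphisms S)) \<rightarrow> spectral_map R ` alg_endomorphisms R"
      using \<phi>_spec by auto
  qed
  have cont_\<psi>: "continuous_map (spectral_space R) (spectral_space S) \<psi>"
    unfolding spectral_space_def
  proof (rule continuous_map_into_subtopology)
    show "continuous_map (subtopology (compact_open (max_topology R) (max_topology R))
        (spectral_map R ` alg_endomorphisms R)) (compact_open (max_topology S) (max_topology S)) \<psi>"
      using continuous_map_compact_open_compose[OF cont_p cont_i]
      unfolding topS \<psi>_def by (rule continuous_map_from_subtopology)
    show "\<psi> \<in> topspace (subtopology (compact_open (max_topology R) (max_topology R))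
        (spectral_map R ` alg_endomorphisms R)) \<rightarrow> spectral_map S ` alg_endomorphisms S"
      using \<psi>_spec by auto
  qed
  have \<psi>\<phi>: "\<psi> (\<phi> k) = k" if "k \<in> topspace (spectral_space S)" for k
  proof -
    have "k \<in> extensional (Max_Spec S)" "k \<in> Max_Spec S \<rightarrow> Max_Spec S"
      using that by (auto simp: spectral_space_def topspace_compact_open continuous_maps_def
          continuous_map_def topS)
    then show ?thesis
      by (auto simp: \<psi>_def \<phi>_def ip_pull p_max Pi_iff extensional_def fun_eq_iff)
  qed
  have id: "(\<lambda>x \<in> carrier S. x) \<in> alg_endomorphisms S"
    using identity_alg_endomorphism[OF S smult_S] .
  have spec_id: "spectral_map S (\<lambda>x \<in> carrier S. x) = (\<lambda>M \<in> Max_Spec S. M)"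
    using spectral_map_id[OF S smult_S res_S] .
  have "spectral_map R (\<lambda>x \<in> carrier R. x) = (\<lambda>M \<in> Max_Spec R. M)"
    using spectral_map_id[OF R smult_R res_R] .
  also have "\<dots> = \<phi> (spectral_map S (\<lambda>x \<in> carrier S. x))"
    by (auto simp: \<phi>_def spec_id i_max pi_pull intro!: ext)
  finally have base: "spectral_map R (\<lambda>x \<in> carrier R. x) = \<phi> (spectral_map S (\<lambda>x \<in> carrier S. x))" .
  have "continuous_map (max_topology S) (max_topology S) (\<lambda>M \<in> Max_Spec S. M)"
    by (rule continuous_map_eq[OF continuous_map_id]) (simp add: topS)
  then have "spectral_map S (\<lambda>x \<in> carrier S. x) \<in> topspace (spectral_space S)"
    using id by (auto simp: spectral_space_def topspace_compact_open continuous_maps_def topS spec_id[symmetric])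
       (simp add: spec_id)
  moreover have "trivial_group (fundamental_group (spectral_space R)
      (\<phi> (spectral_map S (\<lambda>x \<in> carrier S. x))))"
    using trivial by (simp only: spectral_fundamental_group_def base)
  ultimately show ?thesis
    unfolding spectral_fundamental_group_def
    using trivial_fundamental_group_retract[where \<phi> = \<phi> and \<psi> = \<psi>] cont_\<phi> cont_\<psi> \<psi>\<phi> by metis
qed

section \<open>The algebra of continuous functions\<close>

lemma restrict_in_continuous_maps:
  assumes "continuous_map T Z f"
  shows "restrict f (topspace T) \<in> continuous_maps T Z"
  using continuous_map_eq[OF assms, of "restrict f (topspace T)"]
  by (simp add: continuous_maps_def)

lemma cont_algebra_simps:
  "carrier (cont_algebra T) = continuous_maps T euclideanreal"
  "f \<otimes>\<^bsub>cont_algebra T\<^esub> g = (\<lambda>t \<in> topspace T. f t * g t)"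
  "\<one>\<^bsub>cont_algebra T\<^esub> = (\<lambda>t \<in> topspace T. 1)"
  "\<zero>\<^bsub>cont_algebra T\<^esub> = (\<lambda>t \<in> topspace T. 0)"
  "f \<oplus>\<^bsub>cont_algebra T\<^esub> g = (\<lambda>t \<in> topspace T. f t + g t)"
  "c \<odot>\<^bsub>cont_algebra T\<^esub> f = (\<lambda>t \<in> topspace T. c * f t)"
  by (simp_all add: cont_algebra_def)

lemma cont_algebra_closed:
  shows "f \<in> carrier (cont_algebra T) \<Longrightarrow> g \<in> carrier (cont_algebra T) \<Longrightarrow>
      f \<otimes>\<^bsub>cont_algebra T\<^esub> g \<in> carrier (cont_algebra T)"
    and "f \<in> carrier (cont_algebra T) \<Longrightarrow> g \<in> carrier (cont_algebra T) \<Longrightarrow>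
      f \<oplus>\<^bsub>cont_algebra T\<^esub> g \<in> carrier (cont_algebra T)"
    and "f \<in> carrier (cont_algebra T) \<Longrightarrow> c \<odot>\<^bsub>cont_algebra T\<^esub> f \<in> carrier (cont_algebra T)"
    and "\<one>\<^bsub>cont_algebra T\<^esub> \<in> carrier (cont_algebra T)"
    and "\<zero>\<^bsub>cont_algebra T\<^esub> \<in> carrier (cont_algebra T)"
  unfolding cont_algebra_simps
  by (auto intro!: restrict_in_continuous_maps continuous_intros
      simp: continuous_maps_def[of T euclideanreal])

lemma cring_cont_algebra: "cring (cont_algebra T)"
proof (intro cringI abelian_groupI comm_monoidI)
  fix f assume "f \<in> carrier (cont_algebra T)"
  show "\<exists>g \<in> carrier (cont_algebra T). g \<oplus>\<^bsub>cont_algebra T\<^esub> f = \<zero>\<^bsub>cont_algebra T\<^esub>"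
  proof
    show "(-1) \<odot>\<^bsub>cont_algebra T\<^esub> f \<in> carrier (cont_algebra T)"
      using cont_algebra_closed(3) \<open>f \<in> _\<close> by blast
    show "((-1) \<odot>\<^bsub>cont_algebra T\<^esub> f) \<oplus>\<^bsub>cont_algebra T\<^esub> f = \<zero>\<^bsub>cont_algebra T\<^esub>"
      by (simp add: cont_algebra_simps fun_eq_iff)
  qed
qed (simp_all only: cont_algebra_closed,
   auto simp: cont_algebra_simps continuous_maps_def extensional_def fun_eq_iff algebra_simps)


text \<open>If no point were a common zero of \<open>M\<close>, then by compactness finitely many members of \<open>M\<close> would have
  no common zero; the sum of their squares would be an invertible member of \<open>M\<close>.\<close>

lemma maximal_ideal_cont_algebra:
  assumes T: "compact_space T" and M: "maximalideal M (cont_algebra T)"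
  obtains t where "t \<in> topspace T" "\<And>f. f \<in> M \<Longrightarrow> f t = 0"
proof (rule ccontr)
  let ?C = "cont_algebra T"
  interpret cring ?C by (rule cring_cont_algebra)
  interpret M: maximalideal M ?C by fact
  assume "\<not> thesis"
  then have nonzero: "\<forall>t \<in> topspace T. \<exists>f \<in> M. f t \<noteq> 0" using that by blast
  have cont: "continuous_map T euclideanreal f" if "f \<in> M" for f
    using M.Icarr[OF that] by (simp add: cont_algebra_simps continuous_maps_def)
  let ?U = "\<lambda>f. {t \<in> topspace T. f t \<in> - {0::real}}"
  have "\<exists>F. finite F \<and> F \<subseteq> ?U ` M \<and> topspace T \<subseteq> \<Union>F"
  proof -
    have "openin T (?U f)" if "f \<in> M" for f
      by (rule openin_continuous_map_preimage[OF cont[OF that]]) (simp add: open_Compl)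
    moreover have "topspace T \<subseteq> \<Union>(?U ` M)"
      using nonzero by auto
    ultimately show ?thesis
      using T[unfolded compact_space_alt, rule_format, of "?U ` M"] by blast
  qed
  then obtain \<F> where \<F>: "finite \<F>" "\<F> \<subseteq> ?U ` M" "topspace T \<subseteq> \<Union>\<F>"
    by blast
  obtain F where F: "finite F" "F \<subseteq> M" "topspace T \<subseteq> \<Union>(?U ` F)"
    using finite_subset_image[OF \<F>(1,2)] \<F>(3) by blast
  have "\<exists>g \<in> M. \<forall>t \<in> topspace T. 0 \<le> g t \<and> ((\<exists>f \<in> F. f t \<noteq> 0) \<longrightarrow> 0 < g t)"
    using F(1,2)
  proof (induction F)
    case empty
    show ?case
      using M.zero_closed by (intro bexI[of _ "\<zero>\<^bsub>?C\<^esub>"]) (simp_all add: cont_algebra_simps(4)[of T])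
  next
    case (insert f F)
    then obtain g where g: "g \<in> M" "\<forall>t \<in> topspace T. 0 \<le> g t \<and> ((\<exists>f \<in> F. f t \<noteq> 0) \<longrightarrow> 0 < g t)"
      by auto
    have "f \<in> M" using insert by simp
    show ?case
    proof (intro bexI ballI conjI impI)
      show "f \<otimes>\<^bsub>?C\<^esub> f \<oplus>\<^bsub>?C\<^esub> g \<in> M"
        using \<open>f \<in> M\<close> g M.Icarr by (intro M.a_closed M.I_l_closed) auto
      fix t assume t: "t \<in> topspace T"
      have eq: "(f \<otimes>\<^bsub>?C\<^esub> f \<oplus>\<^bsub>?C\<^esub> g) t = f t * f t + g t"
        using t by (simp add: cont_algebra_simps)
      show "0 \<le> (f \<otimes>\<^bsub>?C\<^esub> f \<oplus>\<^bsub>?C\<^esub> g) t"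
        using g t unfolding eq by simp
      assume "\<exists>f' \<in> insert f F. f' t \<noteq> 0"
      then show "0 < (f \<otimes>\<^bsub>?C\<^esub> f \<oplus>\<^bsub>?C\<^esub> g) t"
        using g t unfolding eq
        by (cases "f t = 0") (auto intro: add_pos_nonneg simp flip: power2_eq_square)
    qed
  qed
  then obtain g where g: "g \<in> M" and pos: "\<And>t. t \<in> topspace T \<Longrightarrow> 0 < g t"
    using F(3) by fastforce
  let ?h = "\<lambda>t \<in> topspace T. inverse (g t)"
  have "?h \<in> carrier ?C"
    unfolding cont_algebra_simps
    by (intro restrict_in_continuous_maps continuous_map_real_inverse cont g) (use pos in force)
  then have "?h \<otimes>\<^bsub>?C\<^esub> g \<in> M" using g by (intro M.I_l_closed)
  also have "?h \<otimes>\<^bsub>?C\<^esub> g = \<one>\<^bsub>?C\<^esub>"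
    using pos by (auto simp: cont_algebra_simps fun_eq_iff) force
  finally show False using M.one_imp_carrier M.I_notcarr by simp
qed

text \<open>The residue of \<open>f\<close> is its value at the common zero \<open>t\<close> of \<open>M\<close>: if \<open>f - f(t)\<close> were invertible modulo
  \<open>M\<close>, then some member of \<open>M\<close> would have the value \<open>1\<close> at \<open>t\<close>.\<close>

lemma real_residues_cont_algebra:
  assumes "compact_space T"
  shows "real_residues (cont_algebra T)"
  unfolding real_residues_def
proof (intro ballI)
  let ?C = "cont_algebra T"
  interpret cring ?C by (rule cring_cont_algebra)
  fix M f assume "M \<in> Max_Spec ?C" and f: "f \<in> carrier ?C"
  then interpret M: maximalideal M ?C by (simp add: Max_Spec_def)
  obtain t where t: "t \<in> topspace T" "\<And>f. f \<in> M \<Longrightarrow> f t = 0"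
    using maximal_ideal_cont_algebra[OF assms M.is_maximalideal] by blast
  have minus: "(g \<ominus>\<^bsub>?C\<^esub> h) t = g t - h t" if "g \<in> carrier ?C" "h \<in> carrier ?C" for g h
  proof -
    have "((g \<ominus>\<^bsub>?C\<^esub> h) \<oplus>\<^bsub>?C\<^esub> h) t = g t"
      using that by (simp add: a_minus_def a_assoc l_neg)
    then show ?thesis using t by (simp add: cont_algebra_simps)
  qed
  have scalar: "f t \<odot>\<^bsub>?C\<^esub> \<one>\<^bsub>?C\<^esub> \<in> carrier ?C"
    by (intro cont_algebra_closed(3,4))
  let ?d = "f \<ominus>\<^bsub>?C\<^esub> f t \<odot>\<^bsub>?C\<^esub> \<one>\<^bsub>?C\<^esub>"
  have "?d \<in> M"
  proof (rule ccontr)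
    assume "?d \<notin> M"
    then obtain z where z: "z \<in> carrier ?C" "\<one>\<^bsub>?C\<^esub> \<ominus>\<^bsub>?C\<^esub> z \<otimes>\<^bsub>?C\<^esub> ?d \<in> M"
      using M.inverse_mod[OF is_cring, of ?d] f scalar by blast
    have "?d t = 0"
      using minus[OF f scalar] t by (simp add: cont_algebra_simps)
    then have "(\<one>\<^bsub>?C\<^esub> \<ominus>\<^bsub>?C\<^esub> z \<otimes>\<^bsub>?C\<^esub> ?d) t = 1"
      using minus[OF one_closed m_closed[OF z(1) minus_closed[OF f scalar]]] t
      by (simp add: cont_algebra_simps(2,3))
    then show False using t(2)[OF z(2)] by simp
  qed
  then show "\<exists>c. c \<odot>\<^bsub>?C\<^esub> \<one>\<^bsub>?C\<^esub> \<in> carrier ?C \<and> f \<ominus>\<^bsub>?C\<^esub> c \<odot>\<^bsub>?C\<^esub> \<one>\<^bsub>?C\<^esub> \<in> M"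
    using scalar by blast
qed

section \<open>Polynomial algebras\<close>

lemma finite_submultisets: "finite {k. k \<subseteq># m}"
proof (induction m)
  case (add x m)
  have "{k. k \<subseteq># add_mset x m} \<subseteq> {k. k \<subseteq># m} \<union> add_mset x ` {k. k \<subseteq># m}"
  proof
    fix k assume "k \<in> {k. k \<subseteq># add_mset x m}"
    then have k: "k \<subseteq># add_mset x m" by simp
    show "k \<in> {k. k \<subseteq># m} \<union> add_mset x ` {k. k \<subseteq># m}"
    proof (cases "x \<in># k")
      case True
      then have "k = add_mset x (k - {#x#})" by simp
      moreover have "k - {#x#} \<subseteq># m" using k by (simp add: subset_eq_diff_conv)
      ultimately show ?thesis by blast
    next
      case False
      then have "k \<subseteq># m"
        using k by (metis diff_single_trivial subset_eq_diff_conv add_mset_add_single)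
      then show ?thesis by simp
    qed
  qed
  then show ?case using add finite_subset by blast
qed simp

lemma diff_diff_submultiset: "k \<subseteq># m \<Longrightarrow> m - (m - k) = k"
  by (simp add: multiset_eq_iff subseteq_mset_def)

lemma submultiset_remove_iff:
  assumes "i \<in># m"
  shows "k \<subseteq># m - {#i#} \<longleftrightarrow> k \<subseteq># m \<and> i \<in># m - k"
proof
  assume L: "k \<subseteq># m - {#i#}"
  have "count k i \<le> count m i - 1" using mset_subset_eq_count[OF L, of i] by simp
  moreover have "count m i > 0" using assms by simp
  ultimately have "i \<in># m - k" unfolding in_diff_count by linarith
  then show "k \<subseteq># m \<and> i \<in># m - k"
    using subset_mset.order_trans[OF L diff_subset_eq_self] by simp
next
  assume R: "k \<subseteq># m \<and> i \<in># m - k"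
  then have i: "count k i < count m i" by (simp add: in_diff_count)
  show "k \<subseteq># m - {#i#}"
  proof (rule mset_subset_eqI)
    fix a
    show "count k a \<le> count (m - {#i#}) a"
      using R i mset_subset_eq_count[of k m a] by (cases "a = i") auto
  qed
qed

context cring
begin

text \<open>The multiplication of \<^const>\<open>poly_algebra\<close>. Polynomials arise from constants by addition and by
  multiplication with indeterminates, so the laws \<open>indexed_mult_const\<close>, \<open>indexed_mult_padd\<close> and
  \<open>indexed_mult_pmult\<close> allow inductive proofs over one of its arguments.\<close>

definition indexed_mult :: "('c multiset \<Rightarrow> 'a) \<Rightarrow> ('c multiset \<Rightarrow> 'a) \<Rightarrow> 'c multiset \<Rightarrow> 'a"
  where "indexed_mult P Q = (\<lambda>m. \<Oplus>k \<in> {k. k \<subseteq># m}. P k \<otimes> Q (m - k))"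

lemma indexed_mult_closed:
  assumes "carrier_coeff P" "carrier_coeff Q"
  shows "carrier_coeff (indexed_mult P Q)"
  using assms by (simp add: carrier_coeff_def indexed_mult_def)

lemma indexed_mult_comm:
  fixes P Q :: "'c multiset \<Rightarrow> 'a"
  assumes "carrier_coeff P" "carrier_coeff Q"
  shows "indexed_mult P Q = indexed_mult Q P"
proof
  fix m :: "'c multiset"
  have inj: "inj_on ((-) m) {k. k \<subseteq># m}"
    by (rule inj_on_inverseI[where g = "(-) m"]) (simp add: diff_diff_submultiset)
  have img: "(-) m ` {k. k \<subseteq># m} = {k. k \<subseteq># m}"
  proof
    show "{k. k \<subseteq># m} \<subseteq> (-) m ` {k. k \<subseteq># m}"
    proof
      fix k assume "k \<in> {k. k \<subseteq># m}"
      then have "k = m - (m - k)" "m - k \<subseteq># m" by (simp_all add: diff_diff_submultiset)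
      then show "k \<in> (-) m ` {k. k \<subseteq># m}" by blast
    qed
  qed auto
  have "indexed_mult P Q m = (\<Oplus>k \<in> (-) m ` {k. k \<subseteq># m}. P k \<otimes> Q (m - k))"
    by (simp add: indexed_mult_def img)
  also have "\<dots> = (\<Oplus>k \<in> {k. k \<subseteq># m}. P (m - k) \<otimes> Q (m - (m - k)))"
    using assms by (intro finsum_reindex inj) (simp add: carrier_coeff_def)
  also have "\<dots> = indexed_mult Q P m"
    using assms unfolding indexed_mult_def by (intro finsum_cong') (auto simp: carrier_coeff_def m_comm diff_diff_submultiset)
  finally show "indexed_mult P Q m = indexed_mult Q P m" .
qed

lemma indexed_mult_const:
  assumes "carrier_coeff P" "c \<in> carrier R"
  shows "indexed_mult P (indexed_const c) = (\<lambda>m. P m \<otimes> c)"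
proof
  fix m
  have "indexed_mult P (indexed_const c) m = (\<Oplus>k \<in> {m}. P k \<otimes> c)"
    unfolding indexed_mult_def
  proof (rule add.finprod_mono_neutral_cong_right[OF finite_submultisets])
    fix k assume "k \<in> {k. k \<subseteq># m} - {m}"
    then have "m - k \<noteq> {#}"
      by (metis Diff_iff Diff_eq_empty_iff_mset mem_Collect_eq singletonI subset_mset.antisym)
    then show "P k \<otimes> indexed_const c (m - k) = \<zero>"
      using assms by (simp add: indexed_const_def carrier_coeff_def)
  qed (use assms in \<open>auto simp: indexed_const_def carrier_coeff_def\<close>)
  then show "indexed_mult P (indexed_const c) m = P m \<otimes> c"
    using assms by (simp add: carrier_coeff_def)
qed

lemma indexed_mult_padd:
  assumes "carrier_coeff P" "carrier_coeff Q" "carrier_coeff Q'"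
  shows "indexed_mult P (indexed_padd Q Q') = indexed_padd (indexed_mult P Q) (indexed_mult P Q')"
proof
  fix m
  have "indexed_mult P (indexed_padd Q Q') m = (\<Oplus>k \<in> {k. k \<subseteq># m}. P k \<otimes> Q (m - k) \<oplus> P k \<otimes> Q' (m - k))"
    using assms unfolding indexed_mult_def
    by (intro finsum_cong') (auto simp: carrier_coeff_def indexed_padd_def r_distr)
  also have "\<dots> = indexed_mult P Q m \<oplus> indexed_mult P Q' m"
    using assms unfolding indexed_mult_def by (intro finsum_addf) (auto simp: carrier_coeff_def)
  finally show "indexed_mult P (indexed_padd Q Q') m = indexed_padd (indexed_mult P Q) (indexed_mult P Q') m"
    by (simp add: indexed_padd_def)
qed

text \<open>A submultiset \<open>k\<close> of \<open>m\<close> contributes to the left-hand side if \<open>i\<close> occurs in \<open>m - k\<close>, which means that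
  \<open>k\<close> is a submultiset of \<open>m - {#i#}\<close>.\<close>

lemma indexed_mult_pmult:
  assumes "carrier_coeff P" "carrier_coeff Q"
  shows "indexed_mult P (indexed_pmult Q i) = indexed_pmult (indexed_mult P Q) i"
proof
  fix m
  show "indexed_mult P (indexed_pmult Q i) m = indexed_pmult (indexed_mult P Q) i m"
  proof (cases "i \<in># m")
    case True
    let ?m = "m - {#i#}"
    note sub = submultiset_remove_iff[OF True]
    have "indexed_mult P (indexed_pmult Q i) m = indexed_mult P Q ?m"
      unfolding indexed_mult_def
    proof (rule add.finprod_mono_neutral_cong_right[OF finite_submultisets])
      show "{k. k \<subseteq># ?m} \<subseteq> {k. k \<subseteq># m}" using sub by blast
      show "P k \<otimes> indexed_pmult Q i (m - k) = \<zero>" if "k \<in> {k. k \<subseteq># m} - {k. k \<subseteq># ?m}" for k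
        using that sub assms by (auto simp: indexed_pmult_def carrier_coeff_def)
      show "P k \<otimes> indexed_pmult Q i (m - k) = P k \<otimes> Q (?m - k)" if "k \<in> {k. k \<subseteq># ?m}" for k
        using that sub by (simp add: indexed_pmult_def diff_right_commute)
    qed (use assms in \<open>auto simp: indexed_pmult_def carrier_coeff_def\<close>)
    then show ?thesis using True by (simp add: indexed_pmult_def)
  next
    case False
    then have "i \<notin># m - k" for k by (meson in_diffD)
    then have "indexed_mult P (indexed_pmult Q i) m = (\<Oplus>k \<in> {k. k \<subseteq># m}. \<zero>)"
      using assms unfolding indexed_mult_def
      by (intro finsum_cong') (auto simp: indexed_pmult_def carrier_coeff_def)
    then show ?thesis using False by (simp add: indexed_pmult_def)
  qed
qed

lemma pset_coeff: "P \<in> indexed_pset I (carrier R) \<Longrightarrow> carrier_coeff P"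
  using indexed_pset_in_carrier by blast

lemma pset_const: "c \<in> carrier R \<Longrightarrow> indexed_const c \<in> indexed_pset I (carrier R)"
  by (rule indexed_pset.indexed_const)

lemma pset_scale:
  fixes I :: "'c set"
  assumes "P \<in> indexed_pset I (carrier R)" "c \<in> carrier R"
  shows "(\<lambda>m. P m \<otimes> c) \<in> indexed_pset I (carrier R)"
  using assms(1)
proof induction
  case (indexed_const k)
  have "(\<lambda>m. indexed_const k m \<otimes> c) = (indexed_const (k \<otimes> c) :: 'c multiset \<Rightarrow> 'a)"
    using indexed_const assms(2) by (auto simp: indexed_const_def)
  then show ?case using indexed_const assms(2) by (simp add: pset_const)
next
  case (indexed_padd P Q)
  have "(\<lambda>m. indexed_padd P Q m \<otimes> c) = indexed_padd (\<lambda>m. P m \<otimes> c) (\<lambda>m. Q m \<otimes> c)"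
    using indexed_padd.hyps[THEN pset_coeff] assms(2)
    by (auto simp: indexed_padd_def carrier_coeff_def l_distr)
  then show ?case using indexed_padd.IH by (simp add: indexed_pset.indexed_padd)
next
  case (indexed_pmult P i)
  have "(\<lambda>m. indexed_pmult P i m \<otimes> c) = indexed_pmult (\<lambda>m. P m \<otimes> c) i"
    using assms(2) by (auto simp: indexed_pmult_def)
  then show ?case using indexed_pmult by (simp add: indexed_pset.indexed_pmult)
qed

lemma pset_mult:
  assumes P: "P \<in> indexed_pset I (carrier R)" and Q: "Q \<in> indexed_pset I (carrier R)"
  shows "indexed_mult P Q \<in> indexed_pset I (carrier R)"
  using Q
proof induction
  case (indexed_const k)
  then show ?case by (simp add: indexed_mult_const pset_coeff[OF P] pset_scale[OF P])
next
  case (indexed_padd Q Q')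
  then show ?case
    by (simp add: indexed_mult_padd pset_coeff[OF P] pset_coeff[OF indexed_padd.hyps(1)]
        pset_coeff[OF indexed_padd.hyps(2)] indexed_pset.indexed_padd)
next
  case (indexed_pmult Q i)
  then show ?case
    by (simp add: indexed_mult_pmult pset_coeff[OF P] pset_coeff[OF indexed_pmult.hyps(1)]
        indexed_pset.indexed_pmult)
qed

lemma indexed_mult_assoc:
  fixes I :: "'c set"
  assumes P: "carrier_coeff P" and Q: "carrier_coeff Q" and S: "S \<in> indexed_pset I (carrier R)"
  shows "indexed_mult (indexed_mult P Q) S = indexed_mult P (indexed_mult Q S)"
  using S
proof induction
  case (indexed_const c)
  show ?case
  proof
    fix m :: "'c multiset"
    have "indexed_mult (indexed_mult P Q) (indexed_const c) m = indexed_mult P Q m \<otimes> c"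
      using indexed_mult_const[OF indexed_mult_closed[OF P Q] indexed_const] by (rule fun_cong)
    also have "\<dots> = (\<Oplus>k \<in> {k. k \<subseteq># m}. P k \<otimes> Q (m - k) \<otimes> c)"
      using P Q indexed_const unfolding indexed_mult_def
      by (intro finsum_ldistr finite_submultisets) (auto simp: carrier_coeff_def)
    also have "\<dots> = indexed_mult P (\<lambda>m. Q m \<otimes> c) m"
      using P Q indexed_const unfolding indexed_mult_def
      by (intro finsum_cong') (auto simp: carrier_coeff_def m_assoc)
    also have "\<dots> = indexed_mult P (indexed_mult Q (indexed_const c)) m"
      by (simp only: indexed_mult_const[OF Q indexed_const])
    finally show "indexed_mult (indexed_mult P Q) (indexed_const c) m = indexed_mult P (indexed_mult Q (indexed_const c)) m" .
  qed
next
  case (indexed_padd S S')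
  note S = pset_coeff[OF indexed_padd.hyps(1)] pset_coeff[OF indexed_padd.hyps(2)]
  show ?case
    by (simp only: indexed_mult_padd[OF indexed_mult_closed[OF P Q] S] indexed_mult_padd[OF Q S]
        indexed_mult_padd[OF P indexed_mult_closed[OF Q S(1)] indexed_mult_closed[OF Q S(2)]] indexed_padd.IH)
next
  case (indexed_pmult S i)
  note S = pset_coeff[OF indexed_pmult.hyps(1)]
  show ?case
    by (simp only: indexed_mult_pmult[OF indexed_mult_closed[OF P Q] S] indexed_mult_pmult[OF Q S]
        indexed_mult_pmult[OF P indexed_mult_closed[OF Q S]] indexed_pmult.IH)
qed

end

lemma poly_algebra_simps:
  fixes R :: "('r, 'a, 'm) module_scheme" (structure)
  assumes "cring R"
  shows "carrier (poly_algebra R \<Delta>) = ring.indexed_pset R \<Delta> (carrier R)"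
    "P \<otimes>\<^bsub>poly_algebra R \<Delta>\<^esub> Q = cring.indexed_mult R P Q"
    "\<one>\<^bsub>poly_algebra R \<Delta>\<^esub> = ring.indexed_const R \<one>"
    "\<zero>\<^bsub>poly_algebra R \<Delta>\<^esub> = ring.indexed_const R \<zero>"
    "P \<oplus>\<^bsub>poly_algebra R \<Delta>\<^esub> Q = ring.indexed_padd R P Q"
    "c \<odot>\<^bsub>poly_algebra R \<Delta>\<^esub> P = (\<lambda>m. c \<odot> P m)"
  by (simp_all add: poly_algebra_def cring.indexed_mult_def[OF assms])

lemma cring_poly_algebra:
  fixes R :: "('r, 'a, 'm) module_scheme" (structure) and \<Delta> :: "'d set"
  assumes "cring R"
  shows "cring (poly_algebra R \<Delta>)"
proof -
  interpret cring R by fact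
  let ?P = "poly_algebra R \<Delta>"
  note simps = poly_algebra_simps[OF assms]
  note coeff = pset_coeff[of _ \<Delta>]
  show ?thesis
  proof (intro cringI abelian_groupI comm_monoidI)
    fix P Q S assume P: "P \<in> carrier ?P" and Q: "Q \<in> carrier ?P" and S: "S \<in> carrier ?P"
    note c = P[unfolded simps, THEN coeff] Q[unfolded simps, THEN coeff] S[unfolded simps, THEN coeff]
    show "P \<oplus>\<^bsub>?P\<^esub> Q \<in> carrier ?P" using P Q unfolding simps by (rule indexed_pset.indexed_padd)
    show "P \<oplus>\<^bsub>?P\<^esub> Q \<oplus>\<^bsub>?P\<^esub> S = P \<oplus>\<^bsub>?P\<^esub> (Q \<oplus>\<^bsub>?P\<^esub> S)" "P \<oplus>\<^bsub>?P\<^esub> Q = Q \<oplus>\<^bsub>?P\<^esub> P"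
      using c by (auto simp: simps indexed_padd_def carrier_coeff_def a_ac)
    show "\<zero>\<^bsub>?P\<^esub> \<oplus>\<^bsub>?P\<^esub> P = P" using c by (simp add: simps indexed_padd_zero)
    show "P \<otimes>\<^bsub>?P\<^esub> Q \<in> carrier ?P" using P Q unfolding simps by (rule pset_mult)
    show "P \<otimes>\<^bsub>?P\<^esub> Q \<otimes>\<^bsub>?P\<^esub> S = P \<otimes>\<^bsub>?P\<^esub> (Q \<otimes>\<^bsub>?P\<^esub> S)"
      using indexed_mult_assoc[OF c(1,2)] S unfolding simps .
    show comm: "P \<otimes>\<^bsub>?P\<^esub> Q = Q \<otimes>\<^bsub>?P\<^esub> P"
      unfolding simps by (rule indexed_mult_comm[OF c(1,2)])
    have one: "carrier_coeff (indexed_const \<one> :: 'd multiset \<Rightarrow> 'a)"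
      using coeff[OF pset_const[OF one_closed]] .
    show "\<one>\<^bsub>?P\<^esub> \<otimes>\<^bsub>?P\<^esub> P = P"
      unfolding simps indexed_mult_comm[OF one c(1)] indexed_mult_const[OF c(1) one_closed]
      using c(1) by (simp add: carrier_coeff_def)
    show "(P \<oplus>\<^bsub>?P\<^esub> Q) \<otimes>\<^bsub>?P\<^esub> S = P \<otimes>\<^bsub>?P\<^esub> S \<oplus>\<^bsub>?P\<^esub> Q \<otimes>\<^bsub>?P\<^esub> S"
      unfolding simps indexed_mult_comm[OF indexed_padd_in_carrier[OF c(1,2)] c(3)]
        indexed_mult_padd[OF c(3,1,2)] indexed_mult_comm[OF c(3,1)] indexed_mult_comm[OF c(3,2)] ..
    show "\<exists>Q \<in> carrier ?P. Q \<oplus>\<^bsub>?P\<^esub> P = \<zero>\<^bsub>?P\<^esub>"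
    proof
      \<comment> \<open>negation is multiplication by the constant \<open>\<ominus> \<one>\<close>\<close>
      show "(\<lambda>m. P m \<otimes> \<ominus> \<one>) \<in> carrier ?P"
        using P unfolding simps by (rule pset_scale) simp
      show "(\<lambda>m. P m \<otimes> \<ominus> \<one>) \<oplus>\<^bsub>?P\<^esub> P = \<zero>\<^bsub>?P\<^esub>"
        using c(1) by (simp add: simps indexed_padd_def indexed_zero_def carrier_coeff_def r_minus l_neg)
    qed
  qed (simp_all add: simps pset_const)
qed

section \<open>Scalars and quotient algebras\<close>

text \<open>True in every algebra. In this form scalar multiplication is expressed by the ring structure and is
  thus compatible with ring homomorphisms and ideals.\<close>

definition smult_by_constants :: "('r, 'a, 'm) module_scheme \<Rightarrow> bool"
  where "smult_by_constants R \<longleftrightarrow> (\<forall>c. c \<odot>\<^bsub>R\<^esub> \<one>\<^bsub>R\<^esub> \<in> carrier R) \<and>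
    (\<forall>c. \<forall>x \<in> carrier R. c \<odot>\<^bsub>R\<^esub> x = (c \<odot>\<^bsub>R\<^esub> \<one>\<^bsub>R\<^esub>) \<otimes>\<^bsub>R\<^esub> x)"

lemma smult_by_constantsD:
  assumes "smult_by_constants R"
  shows "c \<odot>\<^bsub>R\<^esub> \<one>\<^bsub>R\<^esub> \<in> carrier R"
    and "x \<in> carrier R \<Longrightarrow> c \<odot>\<^bsub>R\<^esub> x = (c \<odot>\<^bsub>R\<^esub> \<one>\<^bsub>R\<^esub>) \<otimes>\<^bsub>R\<^esub> x"
  using assms unfolding smult_by_constants_def by blast+

lemma smult_closed_of_constants:
  assumes "cring R" "smult_by_constants R" "x \<in> carrier R"
  shows "c \<odot>\<^bsub>R\<^esub> x \<in> carrier R"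
proof -
  interpret cring R by fact
  show ?thesis
    unfolding smult_by_constantsD(2)[OF assms(2,3)]
    by (intro m_closed smult_by_constantsD(1) assms)
qed

lemma indexed_const_alg_hom:
  fixes R :: "('r, 'a, 'm) module_scheme" (structure) and \<Delta> :: "'d set"
  assumes R: "cring R" and smult: "smult_by_constants R"
  shows "ring.indexed_const R \<in> alg_hom R (poly_algebra R \<Delta>)"
proof -
  interpret cring R by fact
  note simps = poly_algebra_simps[OF R]
  have zero: "c \<odot> \<zero> = \<zero>" for c
  proof -
    have "c \<odot> \<zero> = (c \<odot> \<one>) \<otimes> \<zero>"
      using smult zero_closed by (rule smult_by_constantsD(2))
    then show ?thesis using smult_by_constantsD(1)[OF smult, of c] by simp
  qed
  have mult: "indexed_const (a \<otimes> b) = indexed_mult (indexed_const a) (indexed_const b :: 'd multiset \<Rightarrow> 'a)"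
    if "a \<in> carrier R" "b \<in> carrier R" for a b
    unfolding indexed_mult_const[OF pset_coeff[OF pset_const[OF that(1)]] that(2)]
    using that by (auto simp: indexed_const_def)
  show ?thesis
    unfolding alg_hom_def
  proof (intro CollectI conjI ring_hom_memI allI ballI)
    fix c a
    show "indexed_const (c \<odot> a) = c \<odot>\<^bsub>poly_algebra R \<Delta>\<^esub> indexed_const a"
      using zero by (auto simp: simps indexed_const_def)
  qed (simp_all add: simps pset_const mult indexed_padd_const)
qed

lemma constant_term_alg_hom:
  fixes R :: "('r, 'a, 'm) module_scheme" (structure) and \<Delta> :: "'d set"
  assumes R: "cring R"
  shows "(\<lambda>P. P {#}) \<in> alg_hom (poly_algebra R \<Delta>) R"
proof -
  interpret cring R by fact
  note simps = poly_algebra_simps[OF R]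
  show ?thesis
    unfolding alg_hom_def
  proof (intro CollectI conjI ring_hom_memI allI ballI)
    fix P Q assume "P \<in> carrier (poly_algebra R \<Delta>)" "Q \<in> carrier (poly_algebra R \<Delta>)"
    then have c: "P {#} \<in> carrier R" "Q {#} \<in> carrier R"
      by (auto simp: simps dest: pset_coeff carrier_coeffE)
    then show "P {#} \<in> carrier R" by simp
    show "(P \<otimes>\<^bsub>poly_algebra R \<Delta>\<^esub> Q) {#} = P {#} \<otimes> Q {#}"
      using c by (simp add: simps indexed_mult_def)
    show "(P \<oplus>\<^bsub>poly_algebra R \<Delta>\<^esub> Q) {#} = P {#} \<oplus> Q {#}"
      by (simp add: simps indexed_padd_def)
  qed (simp_all add: simps indexed_const_def)
qed

lemma smult_by_constants_poly_algebra:
  fixes R :: "('r, 'a, 'm) module_scheme" (structure) and \<Delta> :: "'d set"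
  assumes R: "cring R" and smult: "smult_by_constants R"
  shows "smult_by_constants (poly_algebra R \<Delta>)"
proof -
  interpret cring R by fact
  let ?P = "poly_algebra R \<Delta>"
  note simps = poly_algebra_simps[OF R]
  have c1: "c \<odot> \<one> \<in> carrier R" for c using smult by (rule smult_by_constantsD(1))
  have const: "c \<odot>\<^bsub>?P\<^esub> \<one>\<^bsub>?P\<^esub> = indexed_const (c \<odot> \<one>)" for c
    using indexed_const_alg_hom[OF R smult, of \<Delta>] by (simp add: alg_hom_def simps(3))
  show ?thesis
    unfolding smult_by_constants_def const
  proof (intro conjI allI ballI)
    show "indexed_const (c \<odot> \<one>) \<in> carrier ?P" for c
      using c1 by (simp add: simps pset_const)
    fix c P assume "P \<in> carrier ?P"
    then have P: "carrier_coeff P" by (simp add: simps pset_coeff)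
    have "c \<odot>\<^bsub>?P\<^esub> P = (\<lambda>m. P m \<otimes> (c \<odot> \<one>))"
    proof
      fix m
      have "P m \<in> carrier R" using P by (rule carrier_coeffE)
      then show "(c \<odot>\<^bsub>?P\<^esub> P) m = P m \<otimes> (c \<odot> \<one>)"
        using smult_by_constantsD(2)[OF smult] c1[of c] m_comm by (simp only: simps)
    qed
    also have "\<dots> = indexed_mult P (indexed_const (c \<odot> \<one>))"
      using indexed_mult_const[OF P c1] by simp
    also have "\<dots> = indexed_const (c \<odot> \<one>) \<otimes>\<^bsub>?P\<^esub> P"
      unfolding simps by (rule indexed_mult_comm[OF P pset_coeff[OF pset_const[OF c1]]])
    finally show "c \<odot>\<^bsub>?P\<^esub> P = indexed_const (c \<odot> \<one>) \<otimes>\<^bsub>?P\<^esub> P" .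
  qed
qed

text \<open>Modulo the indeterminates every polynomial is congruent to its constant term.\<close>

lemma constant_term_zero_in_ideal:
  fixes R :: "('r, 'a, 'm) module_scheme" (structure) and \<Delta> :: "'d set"
  assumes R: "cring R" and J: "ideal J (poly_algebra R \<Delta>)"
    and var: "\<And>\<delta>. \<delta> \<in> \<Delta> \<Longrightarrow> ring.indexed_var R \<delta> \<in> J"
    and P: "P \<in> carrier (poly_algebra R \<Delta>)" and zero: "P {#} = \<zero>"
  shows "P \<in> J"
proof -
  interpret cring R by fact
  let ?P = "poly_algebra R \<Delta>"
  interpret J: ideal J ?P by fact
  note simps = poly_algebra_simps[OF R]
  note coeff = pset_coeff[of _ \<Delta>]
  have "\<exists>j \<in> J. P = indexed_padd j (indexed_const (P {#}))"
    using P unfolding simps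
  proof induction
    case (indexed_const k)
    have eq: "indexed_const k = indexed_padd (indexed_const \<zero>) (indexed_const k :: 'd multiset \<Rightarrow> 'a)"
      using indexed_const by (simp add: indexed_padd_const)
    have coeff_0: "indexed_const k {#} = k" by (simp add: indexed_const_def)
    have "indexed_const \<zero> \<in> J" using additive_subgroup.zero_closed[OF J.is_additive_subgroup] by (simp only: simps)
    then show ?case
      by (rule bexI[rotated]) (unfold coeff_0, rule eq)
  next
    case (indexed_padd P Q)
    then obtain j j' where j: "j \<in> J" "P = indexed_padd j (indexed_const (P {#}))"
      "j' \<in> J" "Q = indexed_padd j' (indexed_const (Q {#}))" by blast
    have "carrier_coeff j" "carrier_coeff j'"
      using J.Icarr j(1,3) coeff by (auto simp: simps)
    moreover have "P {#} \<in> carrier R" "Q {#} \<in> carrier R"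
      using indexed_padd.hyps coeff carrier_coeffE by blast+
    ultimately have "indexed_padd (indexed_padd j (indexed_const (P {#}))) (indexed_padd j' (indexed_const (Q {#})))
        = indexed_padd (indexed_padd j j') (indexed_const (P {#} \<oplus> Q {#}))"
      by (auto simp: indexed_padd_def indexed_const_def carrier_coeff_def a_ac)
    then have "indexed_padd P Q = indexed_padd (indexed_padd j j') (indexed_const (P {#} \<oplus> Q {#}))"
      by (simp only: j(2,4)[symmetric])
    moreover have "indexed_padd P Q {#} = P {#} \<oplus> Q {#}" by (simp add: indexed_padd_def)
    ultimately have "indexed_padd P Q = indexed_padd (indexed_padd j j') (indexed_const (indexed_padd P Q {#}))"
      by (simp only:)
    moreover have "indexed_padd j j' \<in> J"
      using additive_subgroup.a_closed[OF J.is_additive_subgroup j(1,3)] by (simp add: simps)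
    ultimately show ?case by blast
  next
    case (indexed_pmult P i)
    have P: "carrier_coeff P" using indexed_pmult.hyps(1) by (rule coeff)
    have one: "carrier_coeff (indexed_const \<one> :: 'd multiset \<Rightarrow> 'a)"
      using coeff[OF pset_const[OF one_closed]] .
    have "indexed_mult P (indexed_var i) = indexed_pmult (indexed_mult P (indexed_const \<one>)) i"
      unfolding indexed_var_def by (rule indexed_mult_pmult[OF P one])
    also have "indexed_mult P (indexed_const \<one>) = P"
      using P by (simp add: indexed_mult_const carrier_coeff_def)
    finally have "indexed_pmult P i \<in> J"
      using J.I_l_closed[OF var[OF indexed_pmult.hyps(2)], of P] indexed_pmult.hyps(1)
      by (simp add: simps)
    moreover have "carrier_coeff (indexed_pmult P i)" using P by (rule indexed_pmult_in_carrier)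
    then have "indexed_pmult P i = indexed_padd (indexed_pmult P i) (indexed_const (indexed_pmult P i {#}))"
      by (simp add: indexed_pmult_def[of P i] indexed_padd_zero(1)[unfolded indexed_pmult_def] )
    ultimately show ?case by blast
  qed
  then obtain j where j: "j \<in> J" "P = indexed_padd j (indexed_const \<zero>)"
    using zero by auto
  moreover have "carrier_coeff j" using J.Icarr[OF j(1)] coeff by (simp add: simps)
  ultimately show ?thesis by (simp add: indexed_padd_zero)
qed

lemma quotient_algebra_simps:
  fixes R :: "('r, 'a, 'm) module_scheme" (structure)
  shows "carrier (quotient_algebra R I) = carrier (R Quot I)"
  "U \<otimes>\<^bsub>quotient_algebra R I\<^esub> V = U \<otimes>\<^bsub>R Quot I\<^esub> V"
  "\<one>\<^bsub>quotient_algebra R I\<^esub> = \<one>\<^bsub>R Quot I\<^esub>"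
  "\<zero>\<^bsub>quotient_algebra R I\<^esub> = \<zero>\<^bsub>R Quot I\<^esub>"
  "U \<oplus>\<^bsub>quotient_algebra R I\<^esub> V = U \<oplus>\<^bsub>R Quot I\<^esub> V"
  "c \<odot>\<^bsub>quotient_algebra R I\<^esub> U = (\<Union>x\<in>U. I +>\<^bsub>R\<^esub> (c \<odot>\<^bsub>R\<^esub> x))"
  by (simp_all add: quotient_algebra_def ring.defs module.defs)

text \<open>The record differs from \<open>R Quot I\<close> only by the added field for scalar multiplication, so the identity is
  a ring isomorphism.\<close>

lemma cring_quotient_algebra:
  fixes R :: "('r, 'a, 'm) module_scheme"
  assumes "cring R" "ideal I R"
  shows "cring (quotient_algebra R I)"
proof -
  have "cring (R Quot I)" using ideal.quotient_is_cring[OF assms(2,1)] .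
  moreover have "id \<in> ring_iso (R Quot I) (quotient_algebra R I)"
    by (auto simp: ring_iso_def ring_hom_def quotient_algebra_simps)
  ultimately have "cring (quotient_algebra R I \<lparr>zero := id \<zero>\<^bsub>R Quot I\<^esub>\<rparr>)"
    by (rule cring.ring_iso_imp_img_cring)
  moreover have "quotient_algebra R I \<lparr>zero := id \<zero>\<^bsub>R Quot I\<^esub>\<rparr> = quotient_algebra R I"
    by (simp add: quotient_algebra_def ring.defs module.defs)
  ultimately show ?thesis by simp
qed

text \<open>Scalar multiplication of cosets is defined by a union over representatives; as multiplication by a
  constant respects cosets, the union is over equal sets.\<close>

lemma quotient_map_alg_hom:
  fixes R :: "('r, 'a, 'm) module_scheme" (structure)
  assumes R: "cring R" and I: "ideal I R" and smult: "smult_by_constants R"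
  shows "(+>) I \<in> alg_hom R (quotient_algebra R I)"
    and "carrier (quotient_algebra R I) = (+>) I ` carrier R"
proof -
  interpret cring R by fact
  interpret ideal I R by fact
  have hom: "(+>) I \<in> ring_hom R (R Quot I)" by (rule rcos_ring_hom)
  have "I +> (c \<odot> y) = I +> (c \<odot> x)" if x: "x \<in> carrier R" and y: "y \<in> I +> x" for c x y
  proof -
    have y': "y \<in> carrier R" using y x a_r_coset_subset_G[OF a_subset] by blast
    have "I +> y = I +> x" using a_repr_independence[OF y x a_subgroup] by simp
    moreover have "c \<odot> x = (c \<odot> \<one>) \<otimes> x" "c \<odot> y = (c \<odot> \<one>) \<otimes> y" "c \<odot> \<one> \<in> carrier R"
      using smult_by_constantsD[OF smult] x y' by blast+
    ultimately show ?thesis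
      using ring_hom_mult[OF hom] x y' by metis
  qed
  moreover have "x \<in> I +> x" if "x \<in> carrier R" for x
    using a_rcos_self[OF that] .
  ultimately have "I +> (c \<odot> x) = (\<Union>y \<in> I +> x. I +> (c \<odot> y))" if "x \<in> carrier R" for c x
    using that by blast
  then show "(+>) I \<in> alg_hom R (quotient_algebra R I)"
    using hom by (simp add: alg_hom_def ring_hom_def quotient_algebra_simps)
  show "carrier (quotient_algebra R I) = (+>) I ` carrier R"
    by (auto simp: quotient_algebra_simps FactRing_def A_RCOSETS_def')
qed

lemma smult_by_constants_quotient_algebra:
  fixes R :: "('r, 'a, 'm) module_scheme" (structure)
  assumes R: "cring R" and I: "ideal I R" and smult: "smult_by_constants R"
  shows "smult_by_constants (quotient_algebra R I)"
proof -
  interpret cring R by fact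
  let ?A = "quotient_algebra R I"
  note q = quotient_map_alg_hom[OF assms]
  have hom: "(+>) I \<in> ring_hom R ?A" and lin: "\<And>c x. x \<in> carrier R \<Longrightarrow> I +> (c \<odot> x) = c \<odot>\<^bsub>?A\<^esub> (I +> x)"
    using q(1) by (simp_all add: alg_hom_def)
  have c1: "c \<odot> \<one> \<in> carrier R" for c using smult by (rule smult_by_constantsD(1))
  have one: "c \<odot>\<^bsub>?A\<^esub> \<one>\<^bsub>?A\<^esub> = I +> (c \<odot> \<one>)" for c
    using lin[OF one_closed] ring_hom_one[OF hom] by simp
  show ?thesis
    unfolding smult_by_constants_def one
  proof (intro conjI allI ballI)
    show "I +> (c \<odot> \<one>) \<in> carrier ?A" for c using ring_hom_closed[OF hom c1] .
    fix c U assume "U \<in> carrier ?A"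
    then obtain x where x: "x \<in> carrier R" "U = I +> x" using q(2) by auto
    have "c \<odot> x = (c \<odot> \<one>) \<otimes> x" using smult_by_constantsD(2)[OF smult x(1)] .
    then show "c \<odot>\<^bsub>?A\<^esub> U = (I +> (c \<odot> \<one>)) \<otimes>\<^bsub>?A\<^esub> U"
      using lin[OF x(1), of c] ring_hom_mult[OF hom c1 x(1)] x(2) by simp
  qed
qed

lemma quotient_algebra_lift:
  fixes R :: "('r, 'a, 'm) module_scheme" (structure)
  assumes R: "cring R" and I: "ideal I R" and smult: "smult_by_constants R" and S: "cring S"
    and h: "h \<in> alg_hom R S" and ker: "\<forall>i \<in> I. h i = \<zero>\<^bsub>S\<^esub>"
  shows "(\<lambda>U. the_elem (h ` U)) \<in> alg_hom (quotient_algebra R I) S"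
    and "x \<in> carrier R \<Longrightarrow> the_elem (h ` (I +> x)) = h x"
proof -
  interpret cring R by fact
  interpret S: cring S by fact
  interpret ideal I R by fact
  let ?A = "quotient_algebra R I" and ?h = "\<lambda>U. the_elem (h ` U)"
  note q = quotient_map_alg_hom[OF R I smult]
  have h_hom: "h \<in> ring_hom R S" and h_lin: "\<And>c x. x \<in> carrier R \<Longrightarrow> h (c \<odot> x) = c \<odot>\<^bsub>S\<^esub> h x"
    using h by (simp_all add: alg_hom_def)
  have hom: "(+>) I \<in> ring_hom R ?A" and lin: "\<And>c x. x \<in> carrier R \<Longrightarrow> I +> (c \<odot> x) = c \<odot>\<^bsub>?A\<^esub> (I +> x)"
    using q(1) by (simp_all add: alg_hom_def)
  have h_q: "?h (I +> x) = h x" if x: "x \<in> carrier R" for x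
  proof -
    have "h y = h x" if y: "y \<in> I +> x" for y
    proof -
      obtain i where i: "i \<in> I" "y = i \<oplus> x"
        using y by (auto simp: a_r_coset_def')
      then show ?thesis
        using ring_hom_add[OF h_hom Icarr[OF i(1)] x] bspec[OF ker i(1)] ring_hom_closed[OF h_hom x] by simp
    qed
    then have "h ` (I +> x) = {h x}" using a_rcos_self[OF x] by blast
    then show ?thesis by simp
  qed
  then show "x \<in> carrier R \<Longrightarrow> ?h (I +> x) = h x" .
  show "?h \<in> alg_hom ?A S"
    unfolding alg_hom_def
  proof (intro CollectI conjI ring_hom_memI allI ballI)
    show "?h \<one>\<^bsub>?A\<^esub> = \<one>\<^bsub>S\<^esub>"
      using h_q[OF one_closed] ring_hom_one[OF hom] ring_hom_one[OF h_hom] by simp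
    fix U assume "U \<in> carrier ?A"
    then obtain x where x: "x \<in> carrier R" "U = I +> x" using q(2) by auto
    show "?h U \<in> carrier S" using x h_q ring_hom_closed[OF h_hom] by simp
    show "?h (c \<odot>\<^bsub>?A\<^esub> U) = c \<odot>\<^bsub>S\<^esub> ?h U" for c
      using x h_q lin[OF x(1), of c] h_lin[OF x(1)] smult_closed_of_constants[OF R smult x(1)] by metis
    fix V assume "V \<in> carrier ?A"
    then obtain y where y: "y \<in> carrier R" "V = I +> y" using q(2) by auto
    show "?h (U \<otimes>\<^bsub>?A\<^esub> V) = ?h U \<otimes>\<^bsub>S\<^esub> ?h V"
      using x y h_q[OF m_closed[OF x(1) y(1)]] h_q[OF x(1)] h_q[OF y(1)]
        ring_hom_mult[OF hom x(1) y(1)] ring_hom_mult[OF h_hom x(1) y(1)] by simp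
    show "?h (U \<oplus>\<^bsub>?A\<^esub> V) = ?h U \<oplus>\<^bsub>S\<^esub> ?h V"
      using x y h_q[OF add.m_closed[OF x(1) y(1)]] h_q[OF x(1)] h_q[OF y(1)]
        ring_hom_add[OF hom x(1) y(1)] ring_hom_add[OF h_hom x(1) y(1)] by simp
  qed
qed

lemma (in primeideal) nat_pow_in_imp_in:
  assumes "a \<in> carrier R" "a [^] (n::nat) \<in> I"
  shows "a \<in> I"
  using assms(2)
proof (induction n)
  case 0
  then show ?case using one_imp_carrier assms(1) by simp
next
  case (Suc n)
  then show ?case using I_prime[of "a [^] n" a] assms(1) by auto
qed

section \<open>Truncated polynomial algebras over continuous functions\<close>

lemma smult_by_constants_cont_algebra: "smult_by_constants (cont_algebra T)"
  unfolding smult_by_constants_def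
proof (intro conjI allI ballI)
  show "c \<odot>\<^bsub>cont_algebra T\<^esub> \<one>\<^bsub>cont_algebra T\<^esub> \<in> carrier (cont_algebra T)" for c
    by (intro cont_algebra_closed(3,4))
  show "c \<odot>\<^bsub>cont_algebra T\<^esub> f = (c \<odot>\<^bsub>cont_algebra T\<^esub> \<one>\<^bsub>cont_algebra T\<^esub>) \<otimes>\<^bsub>cont_algebra T\<^esub> f" for c f
    by (simp add: cont_algebra_simps cong: restrict_cong)
qed

theorem theorem5p2:
  fixes T :: "'t topology" and \<Delta> :: "'d set" and n :: "'d \<Rightarrow> nat"
  assumes "path_connected_space T" and "compact_space T" and "Hausdorff_space T"
    and "\<forall>\<delta>\<in>\<Delta>. n \<delta> > 1"
    and "\<not> trivial_group (spectral_fundamental_group (cont_algebra T))"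
  shows "\<not> trivial_group (spectral_fundamental_group
    (truncated_poly_algebra (cont_algebra T) \<Delta> n))"
proof
  let ?B = "cont_algebra T"
  let ?P = "poly_algebra ?B \<Delta>"
  let ?x = "\<lambda>\<delta>. ring.indexed_var ?B \<delta>"
  let ?G = "(\<lambda>\<delta>. ?x \<delta> [^]\<^bsub>?P\<^esub> n \<delta>) ` \<Delta>"
  let ?I = "Idl\<^bsub>?P\<^esub> ?G"
  let ?A = "quotient_algebra ?P ?I"
  let ?q = "(+>\<^bsub>?P\<^esub>) ?I"
  assume "trivial_group (spectral_fundamental_group (truncated_poly_algebra ?B \<Delta> n))"
  then have trivial: "trivial_group (spectral_fundamental_group ?A)"
    by (simp add: truncated_poly_algebra_def Let_def)
  note B = cring_cont_algebra[of T] and sB = smult_by_constants_cont_algebra[of T]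
  note P = cring_poly_algebra[OF B, of \<Delta>] and sP = smult_by_constants_poly_algebra[OF B sB, of \<Delta>]
  interpret B: cring ?B by (rule B)
  interpret P: cring ?P by (rule P)
  have x_carrier: "?x \<delta> \<in> carrier ?P" if "\<delta> \<in> \<Delta>" for \<delta>
    unfolding B.indexed_var_def poly_algebra_simps(1)[OF B]
    using that by (intro B.indexed_pset.indexed_pmult B.pset_const B.one_closed)
  have I: "ideal ?I ?P"
    using x_carrier by (intro P.genideal_ideal) auto
  note A = cring_quotient_algebra[OF P I] and sA = smult_by_constants_quotient_algebra[OF P I sP]
  note q = quotient_map_alg_hom[OF P I sP]
  interpret A: cring ?A by (rule A)
  have q_hom: "?q \<in> ring_hom ?P ?A" using q(1) by (simp add: alg_hom_def)
  let ?\<epsilon> = "\<lambda>p :: 'd multiset \<Rightarrow> 't \<Rightarrow> real. p {#}"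
  have \<epsilon>: "?\<epsilon> \<in> alg_hom ?P ?B" by (rule constant_term_alg_hom[OF B])
  then have \<epsilon>_hom: "?\<epsilon> \<in> ring_hom ?P ?B" by (simp add: alg_hom_def)
  interpret \<epsilon>: ring_hom_ring ?P ?B ?\<epsilon>
    using ring_hom_ringI2[OF P.ring_axioms B.ring_axioms \<epsilon>_hom] .
  have \<epsilon>_I: "\<forall>p \<in> ?I. p {#} = \<zero>\<^bsub>?B\<^esub>"
  proof -
    have "?G \<subseteq> a_kernel ?P ?B ?\<epsilon>"
    proof
      fix p assume "p \<in> ?G"
      then obtain \<delta> where \<delta>: "\<delta> \<in> \<Delta>" "p = ?x \<delta> [^]\<^bsub>?P\<^esub> n \<delta>" by blast
      have n: "n \<delta> \<noteq> 0" using assms(4) \<delta>(1) by force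
      have "p {#} = (?x \<delta> {#}) [^]\<^bsub>?B\<^esub> n \<delta>"
        unfolding \<delta>(2) by (rule \<epsilon>.hom_nat_pow[OF x_carrier[OF \<delta>(1)]])
      also have "\<dots> = \<zero>\<^bsub>?B\<^esub>"
        by (simp add: B.indexed_var_def B.indexed_pmult_def B.nat_pow_zero[OF n])
      finally have "p {#} = \<zero>\<^bsub>?B\<^esub>" .
      moreover have "p \<in> carrier ?P"
        unfolding \<delta>(2) by (rule P.nat_pow_closed[OF x_carrier[OF \<delta>(1)]])
      ultimately show "p \<in> a_kernel ?P ?B ?\<epsilon>"
        unfolding a_kernel_def' by blast
    qed
    then have "?I \<subseteq> a_kernel ?P ?B ?\<epsilon>"
      by (rule P.genideal_minimal[OF \<epsilon>.kernel_is_ideal])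
    then show ?thesis unfolding a_kernel_def' by blast
  qed
  let ?\<pi> = "\<lambda>U. the_elem (?\<epsilon> ` U)" and ?\<iota> = "?q \<circ> ring.indexed_const ?B"
  have \<pi>: "?\<pi> \<in> alg_hom ?A ?B"
    by (rule quotient_algebra_lift(1)[OF P I sP B \<epsilon>]) (rule \<epsilon>_I)
  have \<pi>_q: "?\<pi> (?q p) = p {#}" if "p \<in> carrier ?P" for p
    by (rule quotient_algebra_lift(2)[OF P I sP B \<epsilon>]) (rule \<epsilon>_I, rule that)
  have const: "ring.indexed_const ?B \<in> alg_hom ?B ?P" by (rule indexed_const_alg_hom[OF B sB])
  have "trivial_group (spectral_fundamental_group ?B)"
  proof (rule spectral_fundamental_group_retract[OF A B _ _ \<pi> alg_hom_compose[OF const q(1)] _ _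
        real_residues_cont_algebra[OF assms(2)] trivial])
    show "c \<odot>\<^bsub>?A\<^esub> U \<in> carrier ?A" if "U \<in> carrier ?A" for c U
      by (rule smult_closed_of_constants[OF A sA that])
    show "c \<odot>\<^bsub>?B\<^esub> f \<in> carrier ?B" if "f \<in> carrier ?B" for c f
      by (rule smult_closed_of_constants[OF B sB that])
    show "?\<pi> (?\<iota> b) = b" if "b \<in> carrier ?B" for b
    proof -
      have "B.indexed_const b \<in> carrier ?P"
        using that by (simp add: poly_algebra_simps(1)[OF B] B.pset_const)
      from \<pi>_q[OF this] show ?thesis by (simp add: B.indexed_const_def)
    qed
    fix M U assume M: "M \<in> Max_Spec ?A" and U: "U \<in> carrier ?A" "?\<pi> U = \<zero>\<^bsub>?B\<^esub>"
    obtain p where p: "p \<in> carrier ?P" "U = ?q p" using U(1) q(2) by auto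
    have "p {#} = \<zero>\<^bsub>?B\<^esub>" using \<pi>_q[OF p(1)] U(2) p(2) by simp
    interpret M: maximalideal M ?A using M by (simp add: Max_Spec_def)
    have zero_M: "\<zero>\<^bsub>?A\<^esub> \<in> M" by (rule additive_subgroup.zero_closed[OF M.is_additive_subgroup])
    \<comment> \<open>\<open>M\<close> pulls back to a maximal, hence prime, ideal of the polynomial algebra; it contains a power of
      each indeterminate, so it contains the indeterminates and every polynomial without constant term.\<close>
    let ?N = "pullback ?P ?q M"
    have "maximalideal ?N ?P"
    proof (rule pullback_maximalideal[OF P A q_hom M.is_maximalideal])
      fix V assume "V \<in> carrier ?A"
      then obtain v where "v \<in> carrier ?P" "V = ?q v" using q(2) by auto
      then show "\<exists>v \<in> carrier ?P. V \<ominus>\<^bsub>?A\<^esub> ?q v \<in> M"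
        using zero_M \<open>V \<in> carrier ?A\<close> by (intro bexI[of _ v]) (simp_all add: a_minus_def A.r_neg)
    qed
    then interpret N: primeideal ?N ?P by (rule P.maximalideal_prime)
    have "?x \<delta> \<in> ?N" if "\<delta> \<in> \<Delta>" for \<delta>
    proof (rule N.nat_pow_in_imp_in[OF x_carrier[OF that]])
      have "?x \<delta> [^]\<^bsub>?P\<^esub> n \<delta> \<in> ?I"
        using P.genideal_self[of ?G] x_carrier that by blast
      then have q_zero: "?q (?x \<delta> [^]\<^bsub>?P\<^esub> n \<delta>) = \<zero>\<^bsub>?A\<^esub>"
        using P.a_rcos_zero[OF I] by (simp add: quotient_algebra_simps FactRing_def)
      show "?x \<delta> [^]\<^bsub>?P\<^esub> n \<delta> \<in> ?N"
        unfolding pullback_def mem_Collect_eq q_zero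
        by (intro conjI zero_M P.nat_pow_closed x_carrier that)
    qed
    then have "p \<in> ?N"
      using constant_term_zero_in_ideal[OF B N.is_ideal _ p(1)] \<open>p {#} = _\<close> by blast
    then show "U \<in> M"
      unfolding pullback_def mem_Collect_eq p(2) by (rule conjunct2)
  qed
  then show False using assms(5) by simp
qed

end
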